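(* Let $n\ge2$ and let $\lambda$ be a nonzero integral dominant $\mathfrak{sl}_n$-weight with coordinates $\lambda_1\ge\cdots\ge\lambda_{n-1}\ge0$ as below. Then $$\sum_{f\text{ face of }GT_\lambda}(-1)^{\dim f}\varphi(f)=\binom{n}{l_1,\ldots,l_m}_t=\frac{[n]_t!}{[l_1]_t!\cdots[l_m]_t!},$$ where $(l_1,\ldots,l_m)$ is the type of the partition $(\lambda_1,\ldots,\lambda_{n-1},0)$, i.e. its $r$-th largest distinct part occurs $l_r$ times.
   Context: If $\lambda=(a_1,\ldots,a_{n-1})$ in fundamental weights, $\lambda_i=a_i+\cdots+a_{n-1}$. The Gelfand–Tsetlin polytope $GT_\lambda$ is the set of real arrays $(s_{i,j})$, $0\le i\le n-1$, $1\le j\le n-i$, with $s_{0,j}=\lambda_j$ ($s_{0,n}=0$) and $s_{i,j}\ge s_{i+1,j}\ge s_{i,j+1}$ whenever defined. For a face $f$ take a point $A$ in its relative interior; $\varphi(f)=\prod_{l=1}^{n-1}(1-t^l)^{d_l}$ where $d_l$ is the number of pairs $(i,a)$, $1\le i\le n-1$, $a\in\mathbb R$, such that $a$ occurs exactly $l$ times in row $i$ of $A$ and exactly $l-1$ times in row $i-1$ (this depends only on $f$). $[l]_t!=\prod_{i=1}^l(1+t+\cdots+t^{i-1})$. *)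

theory Defs
  imports "HOL-Analysis.Analysis" "HOL-Computational_Algebra.Polynomial_Factorial"
begin

text \<open>
  Throughout, $n$ is the cardinality of the type variable \<open>'n\<close>.  The arrays $(s_{i,j})$ with
  $0 \le i \le n-1$ and $1 \le j \le n-i$ form the Euclidean space \<open>real ^ 'n gt_index\<close>, so that
  \<open>face_of\<close>, \<open>aff_dim\<close> and \<open>rel_interior\<close> are applicable to sets of arrays.
\<close>

typedef 'n gt_index =
  "{(i, j). i \<le> CARD('n::finite) - 1 \<and> 1 \<le> j \<and> j \<le> CARD('n) - i} :: (nat \<times> nat) set"
  morphisms gt_pos gt_at
proof
  show "(0, 1) \<in> {(i, j). i \<le> CARD('n) - 1 \<and> 1 \<le> j \<and> j \<le> CARD('n) - i}"
    by (simp add: Suc_le_eq)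
qed

instance gt_index :: (finite) finite
proof
  have "finite ({(i, j). i \<le> CARD('a) - 1 \<and> 1 \<le> j \<and> j \<le> CARD('a) - i} :: (nat \<times> nat) set)"
    by (rule finite_subset[of _ "{..CARD('a)} \<times> {..CARD('a)}"]) auto
  then show "finite (UNIV :: 'a gt_index set)"
    by (simp only: type_definition.univ[OF type_definition_gt_index] finite_imageI)
qed

text \<open>The entry $s_{i,j}$; only meaningful for positions $(i,j)$ inside the triangle.\<close>

definition entry :: "real ^ ('n::finite) gt_index \<Rightarrow> nat \<Rightarrow> nat \<Rightarrow> real" where
  "entry s i j = s $ gt_at (i, j)"

text \<open>
  \<open>a 1, \<dots>, a (n - 1)\<close> are the coordinates of the integral dominant weight in the basis of
  fundamental weights; all other values of \<open>a\<close> are irrelevant.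
\<close>

definition weight_coord :: "nat \<Rightarrow> (nat \<Rightarrow> nat) \<Rightarrow> nat \<Rightarrow> nat" where
  "weight_coord n a i = (\<Sum>k = i..n - 1. a k)"

definition GT_polytope :: "(nat \<Rightarrow> nat) \<Rightarrow> (real ^ ('n::finite) gt_index) set" where
  "GT_polytope a = {s.
     (\<forall>j \<in> {1..CARD('n) - 1}. entry s 0 j = real (weight_coord CARD('n) a j)) \<and>
     entry s 0 CARD('n) = 0 \<and>
     (\<forall>i j. i + 1 \<le> CARD('n) - 1 \<longrightarrow> 1 \<le> j \<longrightarrow> j \<le> CARD('n) - (i + 1) \<longrightarrow>
        entry s i j \<ge> entry s (i + 1) j \<and> entry s (i + 1) j \<ge> entry s i (j + 1))}"

definition row_mult :: "real ^ ('n::finite) gt_index \<Rightarrow> nat \<Rightarrow> real \<Rightarrow> nat" where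
  "row_mult s i x = card {j \<in> {1..CARD('n) - i}. entry s i j = x}"

definition d_number :: "real ^ ('n::finite) gt_index \<Rightarrow> nat \<Rightarrow> nat" where
  "d_number s l =
     card {(i, x). i \<in> {1..CARD('n) - 1} \<and> row_mult s i x = l \<and> row_mult s (i - 1) x = l - 1}"

abbreviation t_var :: "int poly" where
  "t_var \<equiv> [:0, 1:]"

definition array_weight :: "real ^ ('n::finite) gt_index \<Rightarrow> int poly" where
  "array_weight s = (\<Prod>l = 1..CARD('n) - 1. (1 - t_var ^ l) ^ d_number s l)"

text \<open>The value does not depend on the chosen point of the relative interior.\<close>

definition face_weight :: "(real ^ ('n::finite) gt_index) set \<Rightarrow> int poly" where
  "face_weight f = array_weight (SOME s. s \<in> rel_interior f)"

definition t_fact :: "nat \<Rightarrow> int poly" where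
  "t_fact l = (\<Prod>i = 1..l. \<Sum>k<i. t_var ^ k)"

definition t_multinomial :: "nat \<Rightarrow> nat list \<Rightarrow> int poly fract" where
  "t_multinomial n ls = to_fract (t_fact n) / (\<Prod>l\<leftarrow>ls. to_fract (t_fact l))"

definition partition_type :: "nat list \<Rightarrow> nat list" where
  "partition_type xs = map (count_list xs) (rev (sorted_list_of_set (set xs)))"

end

theory Submission
  imports Defs
begin

text \<open>
  The weight of a face is constant on its relative interior and \<open>(-1)\<close> to its dimension is the
  compactly supported Euler characteristic of that interior, so the sum is an Euler characteristic
  integral over the polytope, and it can be evaluated row by row.

  A face is determined by the set of tight inequalities at a point of its relative interior, and
  each such set is realised by exactly one array in which every entry equals one of its two upper
  neighbours or their midpoint. The dimension of the face is the number of entries that differ from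
  both upper neighbours. The sum over these arrays factors into transitions between consecutive
  rows. By induction the contribution of all rows below the second one is the multinomial of that
  row, and it remains to see that the weights of all second rows, each multiplied by the quotient of
  the products \<open>[l\<^sub>1]\<^sub>t! \<dots> [l\<^sub>m]\<^sub>t!\<close> of the two rows, add up to \<open>[n]\<^sub>t\<close>. Reading the top row from left to right this sum obeys the recursion
  \<open>[l + n]\<^sub>t = [l]\<^sub>t + t\<^sup>l [n]\<^sub>t\<close>.
\<close>

subsection \<open>Sums over consecutive rows\<close>

text \<open>The q-analogues live in a field with an element \<open>t\<close>, so that quotients of
  q-factorials make sense; in the end it is the fraction field of \<open>int poly\<close>.\<close>

definition q_num :: "'a::field \<Rightarrow> nat \<Rightarrow> 'a" where
  "q_num t l = (\<Sum>k<l. t ^ k)"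

definition q_fact :: "'a::field \<Rightarrow> nat \<Rightarrow> 'a" where
  "q_fact t l = (\<Prod>i = 1..l. q_num t i)"

lemma q_num_1 [simp]: "q_num t (Suc 0) = 1"
  by (simp add: q_num_def)

lemma q_num_add: "q_num t (k + l) = q_num t k + t ^ k * q_num t l"
  by (induction l) (simp_all add: q_num_def algebra_simps power_add)

lemma one_minus_mult_q_num: "(1 - t) * q_num t l = 1 - t ^ l"
  by (simp add: q_num_def one_diff_power_eq)

lemma q_fact_0 [simp]: "q_fact t 0 = 1"
  by (simp add: q_fact_def)

lemma q_fact_Suc: "q_fact t (Suc l) = q_num t (Suc l) * q_fact t l"
  by (simp add: q_fact_def mult.commute)

lemma q_fact_nonzero:
  assumes "\<And>l. q_num t (Suc l) \<noteq> 0"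
  shows "q_fact t l \<noteq> 0"
  using assms by (induction l) (simp_all add: q_fact_Suc)

text \<open>
  In place of the whole interval between two upper neighbours, \<open>next_rows\<close> offers its two ends
  and its midpoint, one point for each relatively open cell.
\<close>

fun next_rows :: "'v::linordered_field list \<Rightarrow> 'v list set" where
  "next_rows (x # y # zs) = (\<lambda>(c, r). c # r) ` ({x, y, (x + y) / 2} \<times> next_rows (y # zs))"
| "next_rows _ = {[]}"

fun free_entries :: "'v list \<Rightarrow> 'v list \<Rightarrow> nat" where
  "free_entries (x # y # zs) (c # r) = (if c = x \<or> c = y then 0 else 1) + free_entries (y # zs) r"
| "free_entries _ _ = 0"

lemma finite_next_rows [simp]: "finite (next_rows r)"
  by (induction r rule: next_rows.induct) auto

lemma mem_next_rows_iff:
  assumes "r \<noteq> []"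
  shows "r' \<in> next_rows r \<longleftrightarrow> length r = Suc (length r') \<and>
    (\<forall>j < length r'. r' ! j \<in> {r ! j, r ! Suc j, (r ! j + r ! Suc j) / 2})"
  using assms
proof (induction r arbitrary: r' rule: next_rows.induct)
  case (1 x y zs)
  show ?case
  proof (cases r')
    case Nil
    then show ?thesis by auto
  next
    case (Cons c cs)
    have "r' \<in> next_rows (x # y # zs) \<longleftrightarrow> c \<in> {x, y, (x + y) / 2} \<and> cs \<in> next_rows (y # zs)"
      using Cons by auto
    then show ?thesis
      using "1.IH"[of cs] Cons by (simp add: All_less_Suc2) blast
  qed
qed auto

lemma free_entries_eq_card:
  assumes "length r = Suc (length r')"
  shows "free_entries r r' = card {j. j < length r' \<and> r' ! j \<noteq> r ! j \<and> r' ! j \<noteq> r ! Suc j}"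
proof -
  have "free_entries r r' = (\<Sum>j < length r'. if r' ! j \<noteq> r ! j \<and> r' ! j \<noteq> r ! Suc j then 1 else 0)"
    using assms
    by (induction r r' rule: free_entries.induct)
      (auto simp: sum.lessThan_Suc_shift simp del: sum.lessThan_Suc)
  also have "\<dots> = card {j. j < length r' \<and> r' ! j \<noteq> r ! j \<and> r' ! j \<noteq> r ! Suc j}"
    by (subst sum.inter_filter[symmetric]) (auto intro: arg_cong[where f = card])
  finally show ?thesis .
qed

lemma next_rows_le_hd:
  assumes "r' \<in> next_rows r" "sorted_wrt (\<ge>) r" "z \<in> set r'"
  shows "z \<le> hd r"
  using assms
proof (induction r arbitrary: r' rule: next_rows.induct)
  case (1 x y zs)
  then show ?case by (force simp: field_simps)
qed auto

lemma next_rows_decreasing: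
  assumes "r' \<in> next_rows r" "sorted_wrt (\<ge>) r"
  shows "sorted_wrt (\<ge>) r'"
  using assms
proof (induction r arbitrary: r' rule: next_rows.induct)
  case (1 x y zs)
  from "1.prems"(1) obtain p where p: "r' = (case p of (c, r) \<Rightarrow> c # r)"
      "p \<in> {x, y, (x + y) / 2} \<times> next_rows (y # zs)"
    unfolding next_rows.simps by (rule imageE)
  obtain c r where "p = (c, r)" by (cases p)
  with p have r: "r' = c # r" "c \<in> {x, y, (x + y) / 2}" "r \<in> next_rows (y # zs)"
    by simp_all
  have "y \<le> c" using r(2) "1.prems"(2) by (auto simp: field_simps)
  moreover have "z \<le> y" if "z \<in> set r" for z
    using next_rows_le_hd[OF r(3) _ that] "1.prems"(2) by auto
  ultimately show ?case
    using r "1.IH"[OF r(3)] "1.prems"(2) by force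
qed auto

text \<open>The factor that a single value contributes to the weight, \<open>p\<close> being its
  multiplicity in the upper row and \<open>q\<close> that in the lower one.\<close>

definition step_factor :: "'a::field \<Rightarrow> nat \<Rightarrow> nat \<Rightarrow> 'a" where
  "step_factor t p q = (if q = Suc p then 1 - t ^ q else 1)"

definition row_weight :: "'a::field \<Rightarrow> 'v list \<Rightarrow> 'v list \<Rightarrow> 'a" where
  "row_weight t r r' = (\<Prod>x\<in>set r'. step_factor t (count_list r x) (count_list r' x))"

definition count_fact :: "'a::field \<Rightarrow> 'v list \<Rightarrow> 'a" where
  "count_fact t r = (\<Prod>x\<in>set r. q_fact t (count_list r x))"

text \<open>
  The scaled weight is the row weight times the quotient of the multinomials of the two rows, up to
  the factor \<open>q_num t (length r)\<close>.
\<close>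

definition scaled_factor :: "'a::field \<Rightarrow> nat \<Rightarrow> nat \<Rightarrow> 'a" where
  "scaled_factor t p q = step_factor t p q * q_fact t p / q_fact t q"

definition scaled_weight :: "'a::field \<Rightarrow> 'v list \<Rightarrow> 'v list \<Rightarrow> 'a" where
  "scaled_weight t r r' =
     (\<Prod>x\<in>set r \<union> set r'. scaled_factor t (count_list r x) (count_list r' x))"

text \<open>All three products extend to the values of both rows, since a value missing from a row
  contributes the factor 1.\<close>

lemma scaled_weight_eq: "scaled_weight t r r' = row_weight t r r' * count_fact t r / count_fact t r'"
proof -
  let ?U = "set r \<union> set r'"
  have "row_weight t r r' = (\<Prod>x\<in>?U. step_factor t (count_list r x) (count_list r' x))"
    unfolding row_weight_def
    by (rule prod.mono_neutral_left) (auto simp: step_factor_def)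
  moreover have "count_fact t r = (\<Prod>x\<in>?U. q_fact t (count_list r x))"
    unfolding count_fact_def by (rule prod.mono_neutral_left) auto
  moreover have "count_fact t r' = (\<Prod>x\<in>?U. q_fact t (count_list r' x))"
    unfolding count_fact_def by (rule prod.mono_neutral_left) auto
  ultimately show ?thesis
    by (simp add: scaled_weight_def scaled_factor_def prod.distrib prod_dividef)
qed

text \<open>A product over values splits between lists without common values; this detaches the
  block of the leading value from the rest of the two rows.\<close>

lemma scaled_weight_append:
  assumes "(set p \<union> set q) \<inter> (set p' \<union> set q') = {}"
  shows "scaled_weight t (p @ p') (q @ q') = scaled_weight t p q * scaled_weight t p' q'"
proof -
  have "scaled_weight t (p @ p') (q @ q') =
      (\<Prod>x\<in>(set p \<union> set q) \<union> (set p' \<union> set q').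
        scaled_factor t (count_list (p @ p') x) (count_list (q @ q') x))"
    unfolding scaled_weight_def by (rule prod.cong) auto
  also have "\<dots> = (\<Prod>x\<in>set p \<union> set q. scaled_factor t (count_list (p @ p') x) (count_list (q @ q') x)) *
      (\<Prod>x\<in>set p' \<union> set q'. scaled_factor t (count_list (p @ p') x) (count_list (q @ q') x))"
    by (rule prod.union_disjoint) (use assms in auto)
  also have "(\<Prod>x\<in>set p \<union> set q. scaled_factor t (count_list (p @ p') x) (count_list (q @ q') x)) = scaled_weight t p q"
    unfolding scaled_weight_def using assms
    by (intro prod.cong refl arg_cong2[where f = "scaled_factor t"])
      (auto simp: disjoint_iff count_list_0_iff)
  also have "(\<Prod>x\<in>set p' \<union> set q'. scaled_factor t (count_list (p @ p') x) (count_list (q @ q') x)) = scaled_weight t p' q'"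
    unfolding scaled_weight_def using assms
    by (intro prod.cong refl arg_cong2[where f = "scaled_factor t"])
      (auto simp: disjoint_iff count_list_0_iff)
  finally show ?thesis .
qed

lemma scaled_factor_0_0 [simp]: "scaled_factor t 0 0 = 1"
  by (simp add: scaled_factor_def step_factor_def)

lemma count_list_replicate: "count_list (replicate k v) x = (if x = v then k else 0)"
  by (induction k) auto

lemma scaled_weight_replicate:
  "scaled_weight t (replicate k v) (replicate l v) = scaled_factor t k l"
proof (cases "k = 0 \<and> l = 0")
  case False
  then have "set (replicate k v) \<union> set (replicate l v) = {v}" by auto
  then show ?thesis by (simp add: scaled_weight_def count_list_replicate)
qed (simp add: scaled_weight_def)

text \<open>The multiplicity of a value changes by at most one between interlacing rows, so these
  are the cases that arise. In the last one \<open>1 - t ^ Suc k\<close> equals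
  \<open>(1 - t) * q_num t (Suc k)\<close>, and the q-factorials cancel all but
  \<open>1 - t\<close>.\<close>

lemma scaled_factor_simps:
  assumes "\<And>l. q_num t (Suc l) \<noteq> 0"
  shows "scaled_factor t (Suc k) k = q_num t (Suc k)"
    and "scaled_factor t k k = 1"
    and "scaled_factor t k (Suc k) = 1 - t"
proof -
  note nz = q_fact_nonzero[OF assms]
  show "scaled_factor t (Suc k) k = q_num t (Suc k)" "scaled_factor t k k = 1"
    using nz by (simp_all add: scaled_factor_def step_factor_def q_fact_Suc)
  have "scaled_factor t k (Suc k) = (1 - t ^ Suc k) / q_num t (Suc k)"
    using nz[of k] by (simp add: scaled_factor_def step_factor_def q_fact_Suc)
  also have "\<dots> = 1 - t"
    using assms[of k] by (simp add: one_minus_mult_q_num[symmetric] del: power_Suc)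
  finally show "scaled_factor t k (Suc k) = 1 - t" .
qed

text \<open>
  \<open>k\<close> copies of the leading value of \<open>r\<close> have already been read off the upper row, and \<open>l\<close>
  copies off the lower one. Only \<open>l = k\<close> and \<open>l = k + 1\<close> occur; in the latter case the last free
  entry has come down to the leading value.
\<close>

definition block_sum :: "'a::field \<Rightarrow> nat \<Rightarrow> nat \<Rightarrow> 'v::linordered_field list \<Rightarrow> 'a" where
  "block_sum t k l r = (\<Sum>r'\<in>next_rows r. (-1) ^ free_entries r r' *
     scaled_weight t (replicate k (hd r) @ r) (replicate l (hd r) @ r'))"

text \<open>A repeated leading value forces the first lower entry, so one copy moves into each
  prefix and the sign stays the same.\<close>

lemma block_sum_same: "block_sum t k l (x # x # zs) = block_sum t (Suc k) (Suc l) (x # zs)"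
proof -
  have *: "next_rows (x # x # zs) = (#) x ` next_rows (x # zs)" by auto
  show ?thesis
    unfolding block_sum_def *
    by (subst sum.reindex) (auto simp: replicate_app_Cons_same)
qed

text \<open>When the leading value drops, its block is complete and splits off as one
  \<open>scaled_factor\<close>. The three terms come from the first lower entry: equal to
  \<open>x\<close> it joins the block of \<open>x\<close>, equal to \<open>y\<close> it opens the
  next block, and halfway between it is a free entry with sign \<open>-1\<close> and factor
  \<open>1 - t\<close>.\<close>

lemma block_sum_less:
  assumes nz: "\<And>l. q_num t (Suc l) \<noteq> 0"
    and dec: "sorted_wrt (\<ge>) (x # y # zs)" and "y < x"
  shows "block_sum t k l (x # y # zs) =
    scaled_factor t (Suc k) (Suc l) * block_sum t 0 0 (y # zs) +
    scaled_factor t (Suc k) l * block_sum t 0 1 (y # zs) -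
    scaled_factor t (Suc k) l * (1 - t) * block_sum t 0 0 (y # zs)"
proof -
  define m where "m = (x + y) / 2"
  have m: "y < m" "m < x" using \<open>y < x\<close> by (simp_all add: m_def field_simps)
  let ?N = "next_rows (y # zs)"
  let ?f = "\<lambda>c r. (-1) ^ free_entries (x # y # zs) (c # r) *
     scaled_weight t (replicate k x @ x # y # zs) (replicate l x @ c # r)"
  have le: "z \<le> y" if "r \<in> ?N" "z \<in> set r" for r z
    using next_rows_le_hd[OF that(1) _ that(2)] dec by simp
  have le': "z \<le> y" if "z \<in> set zs" for z
    using dec that by simp
  have A: "?f x r = scaled_factor t (Suc k) (Suc l) * ((-1) ^ free_entries (y # zs) r *
     scaled_weight t (y # zs) r)" if "r \<in> ?N" for r
  proof -
    have "scaled_weight t (replicate k x @ x # y # zs) (replicate l x @ x # r) =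
        scaled_weight t (replicate (Suc k) x @ y # zs) (replicate (Suc l) x @ r)"
      by (simp add: replicate_app_Cons_same)
    also have "\<dots> = scaled_factor t (Suc k) (Suc l) * scaled_weight t (y # zs) r"
      using le[OF that] le' \<open>y < x\<close>
      by (subst scaled_weight_append) (force simp: scaled_weight_replicate simp del: replicate_Suc)+
    finally show ?thesis by simp
  qed
  have B: "?f y r = scaled_factor t (Suc k) l * ((-1) ^ free_entries (y # zs) r *
     scaled_weight t (y # zs) (y # r))" if "r \<in> ?N" for r
  proof -
    have "scaled_weight t (replicate k x @ x # y # zs) (replicate l x @ y # r) =
        scaled_weight t (replicate (Suc k) x @ y # zs) (replicate l x @ y # r)"
      by (simp add: replicate_app_Cons_same)
    also have "\<dots> = scaled_factor t (Suc k) l * scaled_weight t (y # zs) (y # r)"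
      using le[OF that] le' \<open>y < x\<close>
      by (subst scaled_weight_append) (force simp: scaled_weight_replicate simp del: replicate_Suc)+
    finally show ?thesis by simp
  qed
  have C: "?f m r = - (scaled_factor t (Suc k) l * (1 - t) * ((-1) ^ free_entries (y # zs) r *
     scaled_weight t (y # zs) r))" if "r \<in> ?N" for r
  proof -
    have "scaled_weight t (replicate k x @ x # y # zs) (replicate l x @ m # r) =
        scaled_weight t (replicate (Suc k) x @ y # zs) (replicate l x @ m # r)"
      by (simp add: replicate_app_Cons_same)
    also have "\<dots> = scaled_factor t (Suc k) l * scaled_weight t ([] @ y # zs) ([m] @ r)"
      using le[OF that] le' \<open>y < x\<close> m
      by (subst scaled_weight_append) (force simp: scaled_weight_replicate simp del: replicate_Suc)+
    \<comment> \<open>The value \<open>m\<close> lies strictly between \<open>y\<close> and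
      \<open>x\<close>, so it occurs nowhere else and forms a block of its own.\<close>
    also have "scaled_weight t ([] @ y # zs) ([m] @ r) = scaled_weight t [] [m] * scaled_weight t (y # zs) r"
      using le[OF that] le' m
      by (subst scaled_weight_append) force+
    also have "scaled_weight t [] [m] = 1 - t"
      using scaled_factor_simps(3)[OF nz, of 0] by (simp add: scaled_weight_def)
    finally show ?thesis using m by simp
  qed
  have "block_sum t k l (x # y # zs) = (\<Sum>(c, r)\<in>{x, y, m} \<times> ?N. ?f c r)"
    unfolding block_sum_def next_rows.simps(1) m_def[symmetric]
    by (subst sum.reindex) (auto simp: inj_on_def case_prod_unfold)
  also have "\<dots> = (\<Sum>c\<in>{x, y, m}. \<Sum>r\<in>?N. ?f c r)"
    by (simp only: sum.cartesian_product)
  also have "\<dots> = (\<Sum>r\<in>?N. ?f x r) + (\<Sum>r\<in>?N. ?f y r) + (\<Sum>r\<in>?N. ?f m r)"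
    using m \<open>y < x\<close> by (simp del: free_entries.simps add: add.assoc)
  also have "(\<Sum>r\<in>?N. ?f x r) = scaled_factor t (Suc k) (Suc l) * block_sum t 0 0 (y # zs)"
    using A by (simp add: block_sum_def sum_distrib_left cong: sum.cong del: free_entries.simps)
  also have "(\<Sum>r\<in>?N. ?f y r) = scaled_factor t (Suc k) l * block_sum t 0 1 (y # zs)"
    using B by (simp add: block_sum_def sum_distrib_left cong: sum.cong del: free_entries.simps)
  also have "(\<Sum>r\<in>?N. ?f m r) = - (scaled_factor t (Suc k) l * (1 - t) * block_sum t 0 0 (y # zs))"
    using C by (simp add: block_sum_def sum_distrib_left sum_negf cong: sum.cong del: free_entries.simps)
  finally show ?thesis by simp
qed

text \<open>The two claims need a joint induction, since a first lower entry equal to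
  \<open>y\<close> leads from the first to the second. The prefix length \<open>k\<close> is
  arbitrary because a repeated leading value raises it.\<close>

lemma block_sum_eq:
  assumes nz: "\<And>l. q_num t (Suc l) \<noteq> 0" and "sorted_wrt (\<ge>) r" and "r \<noteq> []"
  shows "block_sum t k k r = q_num t (k + length r) \<and> block_sum t k (Suc k) r = 1"
  using assms(2,3)
proof (induction r arbitrary: k rule: next_rows.induct)
  case (1 x y zs)
  note sf = scaled_factor_simps[OF nz]
  have dec: "sorted_wrt (\<ge>) (y # zs)" using "1.prems"(1) by simp
  note IH = "1.IH"[OF dec list.distinct(2)]
  show ?case
  proof (cases "x = y")
    case True
    then show ?thesis using IH[of "Suc k"] by (simp add: block_sum_same)
  next
    case False
    then have "y < x" using "1.prems"(1) by auto
    note step = block_sum_less[OF nz "1.prems"(1) this]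
    let ?n = "length (y # zs)"
    \<comment> \<open>The power \<open>t ^ Suc k\<close> in the recursion is written as
      \<open>1 - (1 - t) * q_num t (Suc k)\<close> to match the three terms of
      \<open>step\<close>.\<close>
    have "q_num t (Suc k + ?n) = q_num t (Suc k) + (1 - (1 - t) * q_num t (Suc k)) * q_num t ?n"
      unfolding one_minus_mult_q_num q_num_add[of t "Suc k" ?n] by simp
    then have "block_sum t k k (x # y # zs) = q_num t (Suc k + ?n)"
      unfolding step using IH[of 0] by (simp add: sf algebra_simps)
    \<comment> \<open>The two terms with the factor \<open>1 - t\<close> cancel, and both factors of
      the remaining term are 1.\<close>
    moreover have "block_sum t k (Suc k) (x # y # zs) = 1"
      unfolding step using IH[of 0] by (simp add: sf)
    ultimately show ?thesis by simp
  qed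
next
  case ("2_2" v)
  \<comment> \<open>Below a single entry there is only the empty row, so the sum is one
    \<open>scaled_factor\<close> of \<open>Suc k\<close> against \<open>k\<close> or
    \<open>Suc k\<close>.\<close>
  have "replicate k v @ [v] = replicate (Suc k) v"
    by (simp add: replicate_append_same)
  then show ?case
    using scaled_factor_simps[OF nz] by (simp add: block_sum_def scaled_weight_replicate del: replicate_Suc)
qed simp

section \<open>Sums over chains of rows\<close>

fun row_chains :: "nat \<Rightarrow> 'v::linordered_field list \<Rightarrow> 'v list list set" where
  "row_chains 0 r = {[r]}"
| "row_chains (Suc m) r = (\<Union>r'\<in>next_rows r. (#) r ` row_chains m r')"

fun chain_weight :: "'a::field \<Rightarrow> 'v list list \<Rightarrow> 'a" where
  "chain_weight t (r # r' # c) =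
     (-1) ^ free_entries r r' * row_weight t r r' * chain_weight t (r' # c)"
| "chain_weight t _ = 1"

lemma row_chains_hd: "c \<in> row_chains m r \<Longrightarrow> \<exists>c'. c = r # c'"
  by (cases m) auto

lemma finite_row_chains [simp]: "finite (row_chains m r)"
  by (induction m arbitrary: r) auto

lemma mem_row_chains_iff:
  "c \<in> row_chains m r \<longleftrightarrow> length c = Suc m \<and> c ! 0 = r \<and> (\<forall>i<m. c ! Suc i \<in> next_rows (c ! i))"
proof (induction m arbitrary: r c)
  case 0
  then show ?case by (cases c) auto
next
  case (Suc m)
  show ?case
  proof (cases c)
    case (Cons r0 c')
    have "c \<in> row_chains (Suc m) r \<longleftrightarrow> r0 = r \<and> (\<exists>r'\<in>next_rows r. c' \<in> row_chains m r')"
      using Cons by auto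
    then show ?thesis
      using Cons by (auto simp: Suc.IH All_less_Suc2)
  qed auto
qed

lemma chain_weight_eq_prod:
  "chain_weight t c = (\<Prod>i<length c - 1. (-1) ^ free_entries (c ! i) (c ! Suc i) * row_weight t (c ! i) (c ! Suc i))"
  by (induction t c rule: chain_weight.induct)
    (auto simp: prod.lessThan_Suc_shift simp del: prod.lessThan_Suc)

text \<open>For a fixed second row the lower rows sum, by induction, to a q-factorial over the
  \<open>count_fact\<close> of that row. This quotient turns the row weight into a scaled weight,
  and the sum over second rows becomes a \<open>block_sum\<close> with nothing read yet, which
  supplies the next factor of the q-factorial.\<close>

lemma sum_chain_weight:
  assumes nz: "\<And>l. q_num t (Suc l) \<noteq> 0" and "sorted_wrt (\<ge>) r" and "length r = Suc m"
  shows "(\<Sum>c\<in>row_chains m r. chain_weight t c) * count_fact t r = q_fact t (Suc m)"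
  using assms(2,3)
proof (induction m arbitrary: r)
  case 0
  then obtain x where "r = [x]" by (auto simp: length_Suc_conv)
  then show ?case by (simp add: count_fact_def)
next
  case (Suc m)
  then have "r \<noteq> []" by auto
  have cf: "count_fact t r' \<noteq> 0" for r' :: "'b list"
    using q_fact_nonzero[OF nz] by (simp add: count_fact_def)
  have "(\<Sum>c\<in>row_chains (Suc m) r. chain_weight t c) =
      (\<Sum>r'\<in>next_rows r. \<Sum>c\<in>(#) r ` row_chains m r'. chain_weight t c)"
    unfolding row_chains.simps
    by (rule sum.UNION_disjoint) (auto dest!: row_chains_hd)
  also have "\<dots> = (\<Sum>r'\<in>next_rows r. (-1) ^ free_entries r r' * row_weight t r r' *
      (\<Sum>c\<in>row_chains m r'. chain_weight t c))"
  proof (rule sum.cong[OF refl])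
    fix r' assume "r' \<in> next_rows r"
    have "(\<Sum>c\<in>(#) r ` row_chains m r'. chain_weight t c) = (\<Sum>c\<in>row_chains m r'. chain_weight t (r # c))"
      by (subst sum.reindex) auto
    also have "\<dots> = (\<Sum>c\<in>row_chains m r'. (-1) ^ free_entries r r' * row_weight t r r' * chain_weight t c)"
      by (rule sum.cong) (auto dest!: row_chains_hd)
    finally show "(\<Sum>c\<in>(#) r ` row_chains m r'. chain_weight t c) = (-1) ^ free_entries r r' * row_weight t r r' *
      (\<Sum>c\<in>row_chains m r'. chain_weight t c)"
      by (simp add: sum_distrib_left)
  qed
  also have "\<dots> * count_fact t r = (\<Sum>r'\<in>next_rows r. (-1) ^ free_entries r r' *
      scaled_weight t r r' * q_fact t (Suc m))"
    unfolding sum_distrib_right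
  proof (rule sum.cong[OF refl])
    fix r' assume r': "r' \<in> next_rows r"
    have "length r' = Suc m"
      using r' \<open>r \<noteq> []\<close> Suc.prems by (simp add: mem_next_rows_iff)
    from Suc.IH[OF next_rows_decreasing[OF r' Suc.prems(1)] this]
    have "q_fact t (Suc m) = (\<Sum>c\<in>row_chains m r'. chain_weight t c) * count_fact t r'" by simp
    then show "(-1) ^ free_entries r r' * row_weight t r r' *
        (\<Sum>c\<in>row_chains m r'. chain_weight t c) * count_fact t r =
        (-1) ^ free_entries r r' * scaled_weight t r r' * q_fact t (Suc m)"
      using cf[of r'] by (simp add: scaled_weight_eq)
  qed
  also have "\<dots> = block_sum t 0 0 r * q_fact t (Suc m)"
    by (simp add: block_sum_def sum_distrib_right)
  also have "\<dots> = q_fact t (Suc (Suc m))"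
    using block_sum_eq[OF nz Suc.prems(1) \<open>r \<noteq> []\<close>, of 0] Suc.prems(2) by (simp add: q_fact_Suc)
  finally show ?case .
qed

subsection \<open>Faces and tight inequalities\<close>

text \<open>The cell \<open>(i, j)\<close> stands for the entry \<open>(i + 1, j)\<close> and its upper neighbours \<open>(i, j)\<close> and \<open>(i, j + 1)\<close>.\<close>

definition cells :: "nat \<Rightarrow> (nat \<times> nat) set" where
  "cells n = {(i, j). 1 \<le> j \<and> i + j < n}"

lemma finite_cells [simp]: "finite (cells n)"
  by (rule finite_subset[of _ "{..n} \<times> {..n}"]) (auto simp: cells_def)

lemma gt_pos_gt_at:
  assumes "1 \<le> j" "i + j \<le> CARD('n::finite)"
  shows "gt_pos (gt_at (i, j) :: 'n gt_index) = (i, j)"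
  using assms by (intro gt_at_inverse) auto

lemma array_eqI:
  fixes s s' :: "real ^ ('n::finite) gt_index"
  assumes "\<And>i j. 1 \<le> j \<Longrightarrow> i + j \<le> CARD('n) \<Longrightarrow> entry s i j = entry s' i j"
  shows "s = s'"
proof (subst vec_eq_iff, rule allI)
  fix p :: "'n gt_index"
  obtain i j where ij: "gt_pos p = (i, j)" by (cases "gt_pos p")
  have "1 \<le> j" "i + j \<le> CARD('n)"
    using gt_pos[of p] unfolding ij by auto
  moreover have "gt_at (i, j) = p" using ij gt_pos_inverse[of p] by simp
  ultimately show "s $ p = s' $ p" using assms[of j i] by (simp add: entry_def)
qed

definition array_of :: "(nat \<Rightarrow> nat \<Rightarrow> real) \<Rightarrow> real ^ ('n::finite) gt_index" where
  "array_of f = (\<chi> p. case gt_pos p of (i, j) \<Rightarrow> f i j)"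

lemma entry_array_of:
  assumes "1 \<le> j" "i + j \<le> CARD('n::finite)"
  shows "entry (array_of f :: real ^ 'n gt_index) i j = f i j"
  using assms by (simp add: entry_def array_of_def gt_pos_gt_at del: One_nat_def)

lemma entry_linear [simp]:
  "entry (x + y) i j = entry x i j + entry y i j"
  "entry (x - y) i j = entry x i j - entry y i j"
  "entry (c *\<^sub>R x) i j = c * entry x i j"
  "entry 0 i j = 0"
  by (simp_all add: entry_def)

lemma continuous_on_entry [continuous_intros]: "continuous_on A (\<lambda>s. entry s i j)"
  unfolding entry_def by (intro continuous_intros)

definition interlacing :: "real ^ ('n::finite) gt_index \<Rightarrow> bool" where
  "interlacing s \<longleftrightarrow> (\<forall>i j. (i, j) \<in> cells CARD('n) \<longrightarrow>
     entry s (Suc i) j \<le> entry s i j \<and> entry s i (Suc j) \<le> entry s (Suc i) j)"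

definition tight_left :: "real ^ ('n::finite) gt_index \<Rightarrow> (nat \<times> nat) set" where
  "tight_left s = {(i, j) \<in> cells CARD('n). entry s (Suc i) j = entry s i j}"

definition tight_right :: "real ^ ('n::finite) gt_index \<Rightarrow> (nat \<times> nat) set" where
  "tight_right s = {(i, j) \<in> cells CARD('n). entry s (Suc i) j = entry s i (Suc j)}"

definition free_cells :: "real ^ ('n::finite) gt_index \<Rightarrow> (nat \<times> nat) set" where
  "free_cells s = cells CARD('n) - tight_left s - tight_right s"

definition gt_set :: "(nat \<Rightarrow> real) \<Rightarrow> (real ^ ('n::finite) gt_index) set" where
  "gt_set g = {s. (\<forall>j \<in> {1..CARD('n)}. entry s 0 j = g j) \<and> interlacing s}"

text \<open>For \<open>s\<close> in \<open>gt_set g\<close> this is the smallest face containing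
  \<open>s\<close>.\<close>

definition face_at ::
    "(nat \<Rightarrow> real) \<Rightarrow> real ^ ('n::finite) gt_index \<Rightarrow> (real ^ 'n gt_index) set" where
  "face_at g s = {p \<in> gt_set g. tight_left s \<subseteq> tight_left p \<and> tight_right s \<subseteq> tight_right p}"

text \<open>The linear space parallel to the affine hull of the face of \<open>s\<close>.\<close>

definition directions :: "real ^ ('n::finite) gt_index \<Rightarrow> (real ^ 'n gt_index) set" where
  "directions s = {v. (\<forall>j \<in> {1..CARD('n)}. entry v 0 j = 0) \<and>
     (\<forall>i j. (i, j) \<in> tight_left s \<longrightarrow> entry v (Suc i) j = entry v i j) \<and>
     (\<forall>i j. (i, j) \<in> tight_right s \<longrightarrow> entry v (Suc i) j = entry v i (Suc j))}"

lemma GT_polytope_eq_gt_set: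
  "GT_polytope a = (gt_set (\<lambda>j. real (weight_coord CARD('n) a j)) :: (real ^ ('n::finite) gt_index) set)"
proof -
  \<comment> \<open>The defining sum is empty here, so the prescribed last entry 0 fits the same
    formula as the other top entries.\<close>
  have last: "weight_coord CARD('n) a CARD('n) = 0"
    by (simp add: weight_coord_def)
  have top: "(\<forall>j \<in> {1..CARD('n)}. P j) \<longleftrightarrow> (\<forall>j \<in> {1..CARD('n) - 1}. P j) \<and> P CARD('n)" for P
  proof -
    have "{1..CARD('n)} = insert CARD('n) {1..CARD('n) - 1}"
      by (auto simp: Suc_le_eq)
    then show ?thesis by auto
  qed
  have "(\<forall>i j. i + 1 \<le> CARD('n) - 1 \<longrightarrow> 1 \<le> j \<longrightarrow> j \<le> CARD('n) - (i + 1) \<longrightarrow>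
        entry s i j \<ge> entry s (i + 1) j \<and> entry s (i + 1) j \<ge> entry s i (j + 1)) \<longleftrightarrow> interlacing s"
    for s :: "real ^ 'n gt_index"
  proof -
    have "i + 1 \<le> CARD('n) - 1 \<and> 1 \<le> j \<and> j \<le> CARD('n) - (i + 1) \<longleftrightarrow> (i, j) \<in> cells CARD('n)" for i j
      by (auto simp: cells_def)
    then show ?thesis unfolding interlacing_def by (simp only: Suc_eq_plus1) blast
  qed
  then show ?thesis
    unfolding GT_polytope_def gt_set_def top by (simp add: last)
qed

lemma interlacing_cell:
  fixes s :: "real ^ ('n::finite) gt_index"
  assumes "interlacing s" "1 \<le> j" "i + j < CARD('n)"
  shows "entry s (Suc i) j \<le> entry s i j" "entry s i (Suc j) \<le> entry s (Suc i) j"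
  using assms by (simp_all add: interlacing_def cells_def)

lemma interlacing_adjacent:
  fixes s :: "real ^ ('n::finite) gt_index"
  assumes "interlacing s" "1 \<le> j" "i + Suc j \<le> CARD('n)"
  shows "entry s i (Suc j) \<le> entry s i j"
  using interlacing_cell[OF assms(1,2), of i] assms(3) by simp

text \<open>
  The array with top row \<open>g\<close> that has the tight inequalities of \<open>s\<close> and whose remaining entries
  are prescribed by \<open>c\<close> as a function of the two upper neighbours.
\<close>

fun rebuild :: "real ^ ('n::finite) gt_index \<Rightarrow> (nat \<Rightarrow> real) \<Rightarrow>
    (nat \<Rightarrow> nat \<Rightarrow> real \<Rightarrow> real \<Rightarrow> real) \<Rightarrow> nat \<Rightarrow> nat \<Rightarrow> real" where
  "rebuild s g c 0 j = g j"
| "rebuild s g c (Suc i) j =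
    (if entry s (Suc i) j = entry s i j then rebuild s g c i j
     else if entry s (Suc i) j = entry s i (Suc j) then rebuild s g c i (Suc j)
     else c i j (rebuild s g c i j) (rebuild s g c i (Suc j)))"

text \<open>Equal adjacent entries are squeezed against the entry between them in the row above, so
  both equal it. The rebuilt entries copy from there, up to a tie one row higher that the induction
  covers.\<close>

lemma rebuild_adjacent_eq:
  fixes s :: "real ^ ('n::finite) gt_index"
  assumes s: "interlacing s"
    and g: "\<And>j. 1 \<le> j \<Longrightarrow> Suc j \<le> CARD('n) \<Longrightarrow> entry s 0 j = entry s 0 (Suc j) \<Longrightarrow> g j = g (Suc j)"
    and "1 \<le> j" "i + Suc j \<le> CARD('n)" "entry s i j = entry s i (Suc j)"
  shows "rebuild s g c i j = rebuild s g c i (Suc j)"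
  using assms(3-)
proof (induction i arbitrary: j)
  case 0
  then show ?case using g by simp
next
  case (Suc i)
  have "entry s i (Suc j) \<le> entry s (Suc i) j" "entry s (Suc i) (Suc j) \<le> entry s i (Suc j)"
    using interlacing_cell[OF s, of j i] interlacing_cell[OF s, of "Suc j" i] Suc.prems by simp_all
  then have eq: "entry s (Suc i) j = entry s i (Suc j)" "entry s (Suc i) (Suc j) = entry s i (Suc j)"
    using Suc.prems(3) by auto
  then show ?case using Suc.IH[of j] Suc.prems by simp
qed

text \<open>\<open>rebuild\<close> tests the left neighbour first. If both inequalities are tight,
  the right one survives because the two rebuilt upper neighbours agree.\<close>

lemma rebuild_tight_right:
  fixes s :: "real ^ ('n::finite) gt_index"
  assumes s: "interlacing s"
    and g: "\<And>j. 1 \<le> j \<Longrightarrow> Suc j \<le> CARD('n) \<Longrightarrow> entry s 0 j = entry s 0 (Suc j) \<Longrightarrow> g j = g (Suc j)"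
    and "1 \<le> j" "i + j < CARD('n)" "entry s (Suc i) j = entry s i (Suc j)"
  shows "rebuild s g c (Suc i) j = rebuild s g c i (Suc j)"
proof (cases "entry s (Suc i) j = entry s i j")
  case True
  have "rebuild s g c i j = rebuild s g c i (Suc j)"
    by (rule rebuild_adjacent_eq[OF s]) (use g assms(3-5) True in auto)
  with True show ?thesis by simp
qed (use assms(5) in simp)

section \<open>Faces, their relative interiors and their dimensions\<close>

lemma convex_gt_set: "convex (gt_set g :: (real ^ ('n::finite) gt_index) set)"
proof (rule convexI)
  fix x y :: "real ^ 'n gt_index" and u v :: real
  assume *: "x \<in> gt_set g" "y \<in> gt_set g" "0 \<le> u" "0 \<le> v" "u + v = 1"
  have "entry (u *\<^sub>R x + v *\<^sub>R y) 0 j = g j" if "j \<in> {1..CARD('n)}" for j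
    using * that by (auto simp: gt_set_def distrib_right[symmetric])
  moreover have "interlacing (u *\<^sub>R x + v *\<^sub>R y)"
    using * by (fastforce simp: gt_set_def interlacing_def intro!: add_mono mult_left_mono)
  ultimately show "u *\<^sub>R x + v *\<^sub>R y \<in> gt_set g"
    by (simp add: gt_set_def)
qed

lemma convex_combination_eq_iff:
  fixes a a' b b' u :: real
  assumes "a \<le> a'" "b \<le> b'" "0 < u" "u < 1"
  shows "(1 - u) * a + u * b = (1 - u) * a' + u * b' \<longleftrightarrow> a = a' \<and> b = b'"
proof -
  have "(1 - u) * a + u * b < (1 - u) * a' + u * b'" if "a < a' \<or> b < b'"
    using that assms
    by (auto intro: add_less_le_mono add_le_less_mono mult_left_mono mult_strict_left_mono)
  then show ?thesis using assms by fastforce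
qed

text \<open>A proper convex combination of nonnegative slacks vanishes only if both slacks do; this
  makes \<open>face_at\<close> an extreme subset.\<close>

lemma tight_convex_combination:
  fixes x y :: "real ^ ('n::finite) gt_index"
  assumes "interlacing x" "interlacing y" "0 < u" "u < 1"
  shows "tight_left ((1 - u) *\<^sub>R x + u *\<^sub>R y) = tight_left x \<inter> tight_left y"
    and "tight_right ((1 - u) *\<^sub>R x + u *\<^sub>R y) = tight_right x \<inter> tight_right y"
proof -
  have "(1 - u) * entry x (Suc i) j + u * entry y (Suc i) j = (1 - u) * entry x i j + u * entry y i j
      \<longleftrightarrow> entry x (Suc i) j = entry x i j \<and> entry y (Suc i) j = entry y i j"
    if "(i, j) \<in> cells CARD('n)" for i j
    using that assms by (intro convex_combination_eq_iff) (auto simp: interlacing_def)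
  then show "tight_left ((1 - u) *\<^sub>R x + u *\<^sub>R y) = tight_left x \<inter> tight_left y"
    by (auto simp: tight_left_def)
  have "(1 - u) * entry x i (Suc j) + u * entry y i (Suc j) = (1 - u) * entry x (Suc i) j + u * entry y (Suc i) j
      \<longleftrightarrow> entry x i (Suc j) = entry x (Suc i) j \<and> entry y i (Suc j) = entry y (Suc i) j"
    if "(i, j) \<in> cells CARD('n)" for i j
    using that assms by (intro convex_combination_eq_iff) (auto simp: interlacing_def)
  then show "tight_right ((1 - u) *\<^sub>R x + u *\<^sub>R y) = tight_right x \<inter> tight_right y"
    unfolding tight_right_def by (auto simp: eq_commute)
qed

lemma face_at_face_of: "face_at g s face_of gt_set g"
  unfolding face_of_def
proof (intro conjI ballI impI)
  show "face_at g s \<subseteq> gt_set g" by (auto simp: face_at_def)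
  show "convex (face_at g s)"
    unfolding convex_alt
  proof (intro ballI allI impI)
    fix x y u assume *: "x \<in> face_at g s" "y \<in> face_at g s" "0 \<le> u \<and> u \<le> (1::real)"
    then have xy: "x \<in> gt_set g" "y \<in> gt_set g" "interlacing x" "interlacing y"
      by (auto simp: face_at_def gt_set_def)
    show "(1 - u) *\<^sub>R x + u *\<^sub>R y \<in> face_at g s"
    proof (cases "u = 0 \<or> u = 1")
      case False
      then have "0 < u" "u < 1" using * by auto
      moreover have "(1 - u) *\<^sub>R x + u *\<^sub>R y \<in> gt_set g"
        using convex_gt_set xy *(3) unfolding convex_alt by blast
      ultimately show ?thesis
        using * tight_convex_combination[OF xy(3,4)] by (simp add: face_at_def)
    qed (use * in auto)
  qed
  fix x y p assume *: "x \<in> gt_set g" "y \<in> gt_set g" "p \<in> face_at g s" "p \<in> open_segment x y"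
  then obtain u where u: "0 < u" "u < 1" "p = (1 - u) *\<^sub>R x + u *\<^sub>R y"
    by (auto simp: in_segment)
  have "interlacing x" "interlacing y" using * by (simp_all add: gt_set_def)
  from tight_convex_combination[OF this u(1,2)]
  have "tight_left p = tight_left x \<inter> tight_left y" "tight_right p = tight_right x \<inter> tight_right y"
    unfolding u(3) .
  then show "x \<in> face_at g s" "y \<in> face_at g s"
    using * by (auto simp: face_at_def)
qed

lemma subspace_directions: "subspace (directions s)"
  by (rule subspaceI) (simp_all add: directions_def)

text \<open>Inequalities that are strict at \<open>s\<close> stay strict in a neighbourhood
  \<open>U\<close>, so near \<open>s\<close> only the equations of the tight ones matter. Both the
  relative interior and the dimension are read off from these two inclusions.\<close>

lemma face_at_sandwich:
  fixes s :: "real ^ ('n::finite) gt_index"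
  assumes s: "s \<in> gt_set g"
  obtains U where "open U" "s \<in> U" "(+) s ` directions s \<inter> U \<subseteq> face_at g s"
    "face_at g s \<subseteq> (+) s ` directions s"
proof
  let ?L = "\<lambda>(i, j). {p :: real ^ 'n gt_index. entry p (Suc i) j < entry p i j}"
  let ?R = "\<lambda>(i, j). {p :: real ^ 'n gt_index. entry p i (Suc j) < entry p (Suc i) j}"
  let ?A = "cells CARD('n) - tight_left s" and ?B = "cells CARD('n) - tight_right s"
  define U where "U = (\<Inter>c\<in>?A. ?L c) \<inter> (\<Inter>c\<in>?B. ?R c)"
  show "open U"
    unfolding U_def
    by (intro open_Int open_INT finite_Diff finite_cells ballI)
      (simp_all add: case_prod_unfold open_Collect_less continuous_on_entry)
  show "s \<in> U"
    using s by (fastforce simp: U_def gt_set_def interlacing_def tight_left_def tight_right_def)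
  show "(+) s ` directions s \<inter> U \<subseteq> face_at g s"
  proof clarify
    fix v assume v: "v \<in> directions s" "s + v \<in> U"
    have L: "entry (s + v) (Suc i) j = entry (s + v) i j" if "(i, j) \<in> tight_left s" for i j
      using v(1) that by (auto simp: directions_def tight_left_def)
    have R: "entry (s + v) (Suc i) j = entry (s + v) i (Suc j)" if "(i, j) \<in> tight_right s" for i j
      using v(1) that by (auto simp: directions_def tight_right_def)
    have "interlacing (s + v)"
      unfolding interlacing_def
    proof clarify
      fix i j assume c: "(i, j) \<in> cells CARD('n)"
      have "entry (s + v) (Suc i) j \<le> entry (s + v) i j"
      proof (cases "(i, j) \<in> tight_left s")
        case False
        then have "s + v \<in> ?L (i, j)" using v(2) c unfolding U_def by blast
        then show ?thesis by simp
      qed (use L in simp)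
      moreover have "entry (s + v) i (Suc j) \<le> entry (s + v) (Suc i) j"
      proof (cases "(i, j) \<in> tight_right s")
        case False
        then have "s + v \<in> ?R (i, j)" using v(2) c unfolding U_def by blast
        then show ?thesis by simp
      qed (use R in simp)
      ultimately show "entry (s + v) (Suc i) j \<le> entry (s + v) i j \<and>
          entry (s + v) i (Suc j) \<le> entry (s + v) (Suc i) j" ..
    qed
    moreover have "tight_left s \<subseteq> tight_left (s + v)"
      using L by (auto simp: tight_left_def)
    moreover have "tight_right s \<subseteq> tight_right (s + v)"
      using R by (auto simp: tight_right_def)
    ultimately show "s + v \<in> face_at g s"
      using s v(1) by (auto simp: face_at_def gt_set_def directions_def)
  qed
  show "face_at g s \<subseteq> (+) s ` directions s"
  proof
    fix p assume p: "p \<in> face_at g s"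
    have "p - s \<in> directions s"
      using p s unfolding face_at_def directions_def gt_set_def tight_left_def tight_right_def
      by auto
    then show "p \<in> (+) s ` directions s"
      by (metis add_diff_cancel_left' add.commute diff_add_cancel image_eqI)
  qed
qed

lemma mem_rel_interior_face_at:
  assumes "s \<in> gt_set g"
  shows "s \<in> rel_interior (face_at g s)"
proof -
  obtain U where U: "open U" "s \<in> U" "(+) s ` directions s \<inter> U \<subseteq> face_at g s"
    "face_at g s \<subseteq> (+) s ` directions s"
    using face_at_sandwich[OF assms] .
  have "affine ((+) s ` directions s)"
    using subspace_directions affine_translation subspace_imp_affine by blast
  then have "affine hull face_at g s \<subseteq> (+) s ` directions s"
    using U(4) by (rule hull_minimal[rotated])
  moreover have "s \<in> face_at g s" using assms by (simp add: face_at_def)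
  ultimately show ?thesis
    unfolding mem_rel_interior using U by blast
qed

lemma aff_dim_face_at:
  assumes "s \<in> gt_set g"
  shows "aff_dim (face_at g s) = int (dim (directions s))"
proof -
  obtain U where U: "open U" "s \<in> U" "(+) s ` directions s \<inter> U \<subseteq> face_at g s"
    "face_at g s \<subseteq> (+) s ` directions s"
    using face_at_sandwich[OF assms] .
  have aff: "affine ((+) s ` directions s)"
    using subspace_directions affine_translation subspace_imp_affine by blast
  have "s \<in> (+) s ` directions s"
    using subspace_0[OF subspace_directions, of s] by force
  \<comment> \<open>Cutting an affine set with an open set that meets it keeps the dimension, so the
    two ends of the sandwich agree.\<close>
  then have "aff_dim ((+) s ` directions s \<inter> U) = aff_dim ((+) s ` directions s)"
    using U(1,2) affine_imp_convex[OF aff] by (intro aff_dim_convex_Int_open) auto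
  moreover have "aff_dim ((+) s ` directions s) = int (dim (directions s))"
    by (simp add: aff_dim_translation_eq aff_dim_subspace subspace_directions)
  ultimately show ?thesis
    using aff_dim_subset[OF U(3)] aff_dim_subset[OF U(4)] by simp
qed

text \<open>Projection to the free entries is an isomorphism onto a coordinate subspace: below a
  zero top row, every other entry of a direction is copied from an upper neighbour, while the free
  ones can be chosen at will.\<close>

lemma dim_directions:
  fixes s :: "real ^ ('n::finite) gt_index"
  assumes s: "interlacing s"
  shows "dim (directions s) = card (free_cells s)"
proof -
  define M :: "'n gt_index set" where "M = (\<lambda>(i, j). gt_at (Suc i, j)) ` free_cells s"
  define f :: "real ^ 'n gt_index \<Rightarrow> real ^ 'n gt_index" where "f v = (\<chi> p. if p \<in> M then v $ p else 0)" for v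
  have free: "1 \<le> j" "i + j < CARD('n)" if "(i, j) \<in> free_cells s" for i j
    using that by (auto simp: free_cells_def cells_def)
  have "inj_on (\<lambda>(i, j). gt_at (Suc i, j) :: 'n gt_index) (free_cells s)"
  proof (rule inj_onI, clarify)
    fix i j i' j'
    assume ij: "(i, j) \<in> free_cells s" "(i', j') \<in> free_cells s"
      and "gt_at (Suc i, j) = (gt_at (Suc i', j') :: 'n gt_index)"
    then have "gt_pos (gt_at (Suc i, j) :: 'n gt_index) = gt_pos (gt_at (Suc i', j') :: 'n gt_index)"
      by simp
    then show "i = i' \<and> j = j'"
      using free[OF ij(1)] free[OF ij(2)] by (simp add: gt_pos_gt_at)
  qed
  then have card_M: "card M = card (free_cells s)"
    by (simp add: M_def card_image)
  have lin: "linear f"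
    by (rule linearI) (auto simp: f_def vec_eq_iff)
  have "v = 0" if v: "v \<in> directions s" "f v = 0" for v
  proof -
    have "entry v i j = 0" if "1 \<le> j" "i + j \<le> CARD('n)" for i j
      using that
    proof (induction i arbitrary: j)
      case 0
      then show ?case using v(1) by (simp add: directions_def)
    next
      case (Suc i)
      have c: "(i, j) \<in> cells CARD('n)" using Suc.prems by (simp add: cells_def)
      have *: "entry v i j = 0" "entry v i (Suc j) = 0" using Suc by auto
      consider "(i, j) \<in> tight_left s" | "(i, j) \<in> tight_right s" | "(i, j) \<in> free_cells s"
        using c by (auto simp: free_cells_def)
      then show ?case
      proof cases
        case 3
        then have "gt_at (Suc i, j) \<in> M" by (auto simp: M_def)
        then have "entry v (Suc i) j = f v $ gt_at (Suc i, j)" by (simp add: entry_def f_def)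
        then show ?thesis by (simp add: v(2))
      qed (use v(1) * in \<open>auto simp: directions_def\<close>)
    qed
    then show "v = 0" by (intro array_eqI) auto
  qed
  then have inj: "inj_on f (directions s)"
    using linear_injective_on_subspace_0[OF lin subspace_directions] by blast
  have "f ` directions s = {x. \<forall>p. p \<notin> M \<longrightarrow> x $ p = 0}"
  proof (intro subset_antisym subsetI)
    fix x :: "real ^ 'n gt_index" assume x: "x \<in> {x. \<forall>p. p \<notin> M \<longrightarrow> x $ p = 0}"
    \<comment> \<open>The preimage of \<open>x\<close> has top row 0 and takes its free entries from
      \<open>x\<close>, whatever their upper neighbours are.\<close>
    define b where "b = rebuild s (\<lambda>_. 0) (\<lambda>i j _ _. entry x (Suc i) j)"
    define v :: "real ^ 'n gt_index" where "v = array_of b"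
    have v: "entry v i j = b i j" if "1 \<le> j" "i + j \<le> CARD('n)" for i j
      using that by (simp add: v_def entry_array_of)
    have "v \<in> directions s"
      using rebuild_tight_right[OF s, of "\<lambda>_. 0"]
      by (auto simp: directions_def tight_left_def tight_right_def cells_def v b_def
          simp del: rebuild.simps(2)) auto
    moreover have "f v = x"
    proof (subst vec_eq_iff, rule allI)
      fix p
      show "f v $ p = x $ p"
      proof (cases "p \<in> M")
        case True
        then obtain i j where ij: "(i, j) \<in> free_cells s" "p = gt_at (Suc i, j)"
          by (auto simp: M_def)
        have "v $ p = entry v (Suc i) j" using ij by (simp add: entry_def)
        also have "\<dots> = entry x (Suc i) j"
          using ij(1) free[OF ij(1)]
          by (simp add: v) (auto simp: b_def free_cells_def tight_left_def tight_right_def)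
        finally show ?thesis using True ij by (simp add: f_def entry_def)
      qed (use x in \<open>simp add: f_def\<close>)
    qed
    ultimately show "x \<in> f ` directions s" by blast
  qed (auto simp: f_def)
  then have "dim (f ` directions s) = card M"
    using dim_substandard_cart[of M, where 'a = real] by (simp add: dim_vec_eq)
  moreover have "dim (f ` directions s) = dim (directions s)"
    using lin inj by (intro dim_image_eq) (simp_all add: span_eq_iff[THEN iffD2, OF subspace_directions])
  ultimately show ?thesis by (simp add: card_M)
qed

text \<open>Faces whose relative interiors meet coincide, so a nonempty face is the
  \<open>face_at\<close> of any point of its relative interior.\<close>

lemma faces_gt_set:
  fixes g :: "nat \<Rightarrow> real"
  shows "{f. f face_of gt_set g \<and> f \<noteq> {}} = face_at g ` (gt_set g :: (real ^ ('n::finite) gt_index) set)"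
proof (intro subset_antisym subsetI)
  fix f :: "(real ^ 'n gt_index) set"
  assume "f \<in> {f. f face_of gt_set g \<and> f \<noteq> {}}"
  then have f: "f face_of gt_set g" "f \<noteq> {}" by auto
  then obtain s where s: "s \<in> rel_interior f"
    using face_of_imp_convex rel_interior_eq_empty by blast
  then have P: "s \<in> gt_set g"
    using f(1) face_of_imp_subset rel_interior_subset by blast
  then have "f = face_at g s"
    using face_of_eq[OF f(1) face_at_face_of[of g s]] mem_rel_interior_face_at s by blast
  then show "f \<in> face_at g ` gt_set g" using P by blast
next
  fix f :: "(real ^ 'n gt_index) set"
  assume "f \<in> face_at g ` gt_set g"
  then show "f \<in> {f. f face_of gt_set g \<and> f \<noteq> {}}"
    using face_at_face_of mem_rel_interior_face_at rel_interior_subset by blast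
qed

lemma face_at_eq_tight:
  assumes "s \<in> gt_set g" "s' \<in> gt_set g" "face_at g s = face_at g s'"
  shows "tight_left s = tight_left s'" "tight_right s = tight_right s'"
proof -
  have "s \<in> face_at g s'" "s' \<in> face_at g s"
    using assms by (auto simp: face_at_def)
  then show "tight_left s = tight_left s'" "tight_right s = tight_right s'"
    by (auto simp: face_at_def)
qed

section \<open>Midpoint arrays as representatives of the faces\<close>

definition midpoint_arrays :: "(nat \<Rightarrow> real) \<Rightarrow> (real ^ ('n::finite) gt_index) set" where
  "midpoint_arrays g = {s \<in> gt_set g. \<forall>(i, j) \<in> cells CARD('n).
     entry s (Suc i) j \<in> {entry s i j, entry s i (Suc j), (entry s i j + entry s i (Suc j)) / 2}}"

text \<open>Going down the rows, the tight inequalities decide which of the three admissible values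
  each entry takes.\<close>

lemma inj_on_face_at: "inj_on (face_at g) (midpoint_arrays g :: (real ^ ('n::finite) gt_index) set)"
proof (rule inj_onI)
  fix s s' :: "real ^ 'n gt_index"
  assume s: "s \<in> midpoint_arrays g" "s' \<in> midpoint_arrays g" "face_at g s = face_at g s'"
  then have P: "s \<in> gt_set g" "s' \<in> gt_set g" by (auto simp: midpoint_arrays_def)
  note tight = face_at_eq_tight[OF P s(3)]
  have "entry s i j = entry s' i j" if "1 \<le> j" "i + j \<le> CARD('n)" for i j
    using that
  proof (induction i arbitrary: j)
    case 0
    then show ?case using P by (simp add: gt_set_def)
  next
    case (Suc i)
    have c: "(i, j) \<in> cells CARD('n)" using Suc.prems by (simp add: cells_def)
    have *: "entry s i j = entry s' i j" "entry s i (Suc j) = entry s' i (Suc j)" using Suc by auto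
    have L: "entry s (Suc i) j = entry s i j \<longleftrightarrow> entry s' (Suc i) j = entry s' i j"
      using tight(1) c unfolding tight_left_def by blast
    have R: "entry s (Suc i) j = entry s i (Suc j) \<longleftrightarrow> entry s' (Suc i) j = entry s' i (Suc j)"
      using tight(2) c unfolding tight_right_def by blast
    have "entry s (Suc i) j \<in> {entry s i j, entry s i (Suc j), (entry s i j + entry s i (Suc j)) / 2}"
      "entry s' (Suc i) j \<in> {entry s' i j, entry s' i (Suc j), (entry s' i j + entry s' i (Suc j)) / 2}"
      using s(1,2) c by (auto simp: midpoint_arrays_def)
    then show ?case using L R * by (metis insert_iff singletonD)
  qed
  then show "s = s'" by (rule array_eqI)
qed

text \<open>Rebuilding \<open>s\<close> with midpoints keeps its ties. The point to check is that no
  new ties appear, that is, that strict drops within a row of \<open>s\<close> remain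
  strict.\<close>

lemma exists_midpoint_array:
  fixes s :: "real ^ ('n::finite) gt_index"
  assumes "s \<in> gt_set g"
  obtains s' :: "real ^ 'n gt_index" where "s' \<in> midpoint_arrays g" "tight_left s' = tight_left s" "tight_right s' = tight_right s"
proof -
  have s: "interlacing s" and g: "\<And>j. 1 \<le> j \<Longrightarrow> j \<le> CARD('n) \<Longrightarrow> entry s 0 j = g j"
    using assms by (auto simp: gt_set_def)
  define b where "b = rebuild s g (\<lambda>_ _ x y. (x + y) / 2)"
  define s' :: "real ^ 'n gt_index" where "s' = array_of b"
  have s': "entry s' i j = b i j" if "1 \<le> j" "i + j \<le> CARD('n)" for i j
    using that by (simp add: s'_def entry_array_of)
  have b_eq: "b i j = b i (Suc j)"
    if "1 \<le> j" "i + Suc j \<le> CARD('n)" "entry s i j = entry s i (Suc j)" for i j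
    unfolding b_def using rebuild_adjacent_eq[OF s _ that, of g] g by auto
  \<comment> \<open>A cell needs strictness only between its two upper neighbours.
    \<open>b_less\<close> carries this from row to row by means of \<open>cell\<close>, and
    \<open>cell'\<close> then drops the condition.\<close>
  have cell: "b i (Suc j) \<le> b (Suc i) j \<and> b (Suc i) j \<le> b i j \<and>
      (b (Suc i) j = b i j \<longleftrightarrow> entry s (Suc i) j = entry s i j) \<and>
      (b (Suc i) j = b i (Suc j) \<longleftrightarrow> entry s (Suc i) j = entry s i (Suc j))"
    if less: "entry s i (Suc j) < entry s i j \<Longrightarrow> b i (Suc j) < b i j"
      and ij: "1 \<le> j" "i + j < CARD('n)" for i j
  proof (cases "entry s i (Suc j) = entry s i j")
    case True
    then have "entry s (Suc i) j = entry s i j" using interlacing_cell[OF s ij] by auto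
    then show ?thesis using True b_eq[of j i] ij by (simp add: b_def)
  next
    case False
    then have "b i (Suc j) < b i j" using interlacing_adjacent[OF s, of j i] ij less by auto
    then show ?thesis
      using False by (auto simp: b_def)
  qed
  have b_less: "b i (Suc j) < b i j"
    if "1 \<le> j" "i + Suc j \<le> CARD('n)" "entry s i (Suc j) < entry s i j" for i j
    using that
  proof (induction i arbitrary: j)
    case 0
    then show ?case using g[of j] g[of "Suc j"] by (simp add: b_def)
  next
    case (Suc i)
    have 1: "b i (Suc j) \<le> b (Suc i) j"
      "b (Suc i) j = b i (Suc j) \<longleftrightarrow> entry s (Suc i) j = entry s i (Suc j)"
      using cell[of i j] Suc by auto
    have 2: "b (Suc i) (Suc j) \<le> b i (Suc j)"
      "b (Suc i) (Suc j) = b i (Suc j) \<longleftrightarrow> entry s (Suc i) (Suc j) = entry s i (Suc j)"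
      using cell[of i "Suc j"] Suc.prems Suc.IH[of "Suc j"] by auto
    \<comment> \<open>The two entries enclose the one between them in the row above. Since they
      differ in \<open>s\<close>, at least one of them differs from it there, and so does the
      rebuilt one.\<close>
    show ?case using 1 2 Suc.prems by (cases "entry s (Suc i) j = entry s i (Suc j)") auto
  qed
  have cell': "b i (Suc j) \<le> b (Suc i) j \<and> b (Suc i) j \<le> b i j \<and>
      (b (Suc i) j = b i j \<longleftrightarrow> entry s (Suc i) j = entry s i j) \<and>
      (b (Suc i) j = b i (Suc j) \<longleftrightarrow> entry s (Suc i) j = entry s i (Suc j))"
    if "1 \<le> j" "i + j < CARD('n)" for i j
    using cell[OF b_less that] that by simp
  have "interlacing s'"
    using cell' by (auto simp: interlacing_def cells_def s')
  moreover have "entry s' 0 j = g j" if "j \<in> {1..CARD('n)}" for j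
    using that by (simp add: s') (simp add: b_def)
  moreover have "entry s' (Suc i) j \<in> {entry s' i j, entry s' i (Suc j), (entry s' i j + entry s' i (Suc j)) / 2}"
    if "(i, j) \<in> cells CARD('n)" for i j
    using that by (simp add: s' cells_def) (simp add: b_def)
  ultimately have "s' \<in> midpoint_arrays g"
    by (auto simp: midpoint_arrays_def gt_set_def)
  moreover have "tight_left s' = tight_left s" "tight_right s' = tight_right s"
    using cell' by (auto simp: tight_left_def tight_right_def cells_def s')
  ultimately show thesis using that by blast
qed

lemma face_at_image: "face_at g ` gt_set g = face_at g ` (midpoint_arrays g :: (real ^ ('n::finite) gt_index) set)"
proof (intro subset_antisym subsetI)
  fix f :: "(real ^ 'n gt_index) set"
  assume "f \<in> face_at g ` gt_set g"
  then obtain s where s: "s \<in> gt_set g" "f = face_at g s" by auto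
  obtain s' :: "real ^ 'n gt_index" where "s' \<in> midpoint_arrays g" "tight_left s' = tight_left s" "tight_right s' = tight_right s"
    by (rule exists_midpoint_array[OF s(1)])
  moreover from this(2,3) have "f = face_at g s'"
    using s(2) by (simp add: face_at_def)
  ultimately show "f \<in> face_at g ` midpoint_arrays g" by blast
qed (auto simp: midpoint_arrays_def)

subsection \<open>From arrays to chains of rows\<close>

definition gt_row :: "real ^ ('n::finite) gt_index \<Rightarrow> nat \<Rightarrow> real list" where
  "gt_row s i = map (entry s i) [1..<Suc (CARD('n) - i)]"

lemma length_gt_row [simp]: "length (gt_row (s :: real ^ ('n::finite) gt_index) i) = CARD('n) - i"
  by (simp add: gt_row_def del: upt_Suc)

lemma nth_gt_row [simp]:
  fixes s :: "real ^ ('n::finite) gt_index"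
  assumes "j < CARD('n) - i"
  shows "gt_row s i ! j = entry s i (Suc j)"
  using assms by (simp add: gt_row_def del: upt_Suc)

lemma row_mult_eq_count_list: "row_mult s i x = count_list (gt_row s i) x"
proof -
  have "count_list (map f xs) x = card {j \<in> set xs. f j = x}" if "distinct xs" for f :: "nat \<Rightarrow> real" and xs
    using that
  proof (induction xs)
    case (Cons y ys)
    have "{j \<in> set (y # ys). f j = x} = (if f y = x then insert y {j \<in> set ys. f j = x} else {j \<in> set ys. f j = x})"
      by auto
    then show ?case using Cons by simp
  qed simp
  then show ?thesis
    by (simp add: row_mult_def gt_row_def atLeastLessThanSuc_atLeastAtMost del: upt_Suc)
qed

lemma to_fract_power: "to_fract (p ^ k) = to_fract p ^ k"
  by (induction k) simp_all

lemma to_fract_prod: "to_fract (prod f A) = (\<Prod>x\<in>A. to_fract (f x))"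
  by (induction A rule: infinite_finite_induct) simp_all

text \<open>The powers counted by \<open>d_number\<close> are regrouped: each pair of a row and a
  value whose multiplicity rises by one gives one factor, and the pairs are then collected by rows
  instead of by multiplicity.\<close>

lemma to_fract_array_weight:
  fixes s :: "real ^ ('n::finite) gt_index"
  shows "to_fract (array_weight s) = (\<Prod>i<CARD('n) - 1. row_weight (to_fract t_var) (gt_row s i) (gt_row s (Suc i)))"
proof -
  let ?t = "to_fract t_var" and ?n = "CARD('n)"
  let ?c = "\<lambda>i x. count_list (gt_row s i) x"
  \<comment> \<open>The pairs counted by all relevant \<open>d_number s l\<close> together, with
    \<open>i\<close> now naming the upper of the two rows.\<close>
  define E where "E = {(i, x). i < ?n - 1 \<and> x \<in> set (gt_row s (Suc i)) \<and> ?c (Suc i) x = Suc (?c i x)}"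
  have fin: "finite E"
    by (rule finite_subset[of _ "Sigma {..<?n - 1} (\<lambda>i. set (gt_row s (Suc i)))"]) (auto simp: E_def)
  have d: "d_number s l = card {e \<in> E. ?c (Suc (fst e)) (snd e) = l}" if "l \<in> {1..?n - 1}" for l
  proof -
    have "{(i, x). i \<in> {1..?n - 1} \<and> row_mult s i x = l \<and> row_mult s (i - 1) x = l - 1} =
        (\<lambda>(i, x). (Suc i, x)) ` {e \<in> E. ?c (Suc (fst e)) (snd e) = l}" (is "?A = ?B")
    proof (intro subset_antisym subsetI)
      fix e assume "e \<in> ?A"
      then obtain i x where e: "e = (i, x)" "i \<in> {1..?n - 1}" "?c i x = l" "?c (i - 1) x = l - 1"
        by (auto simp: row_mult_eq_count_list)
      then obtain k where k: "i = Suc k" by (cases i) auto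
      \<comment> \<open>Here \<open>l\<close> is at least 1, so a value of multiplicity
        \<open>l\<close> really occurs; only finitely many pairs remain.\<close>
      have "x \<in> set (gt_row s i)"
        using e(3) that by (metis atLeastAtMost_iff count_notin not_one_le_zero)
      then have "(k, x) \<in> {e \<in> E. ?c (Suc (fst e)) (snd e) = l}"
        using e k that by (auto simp: E_def)
      then show "e \<in> ?B" using e k by force
    qed (use that in \<open>auto simp: E_def row_mult_eq_count_list\<close>)
    moreover have "inj_on (\<lambda>(i, x). (Suc i, x)) {e \<in> E. ?c (Suc (fst e)) (snd e) = l}"
      by (auto simp: inj_on_def)
    ultimately show ?thesis by (simp add: d_number_def card_image)
  qed
  have "to_fract (array_weight s) = (\<Prod>l = 1..?n - 1. (1 - ?t ^ l) ^ d_number s l)"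
    by (simp add: array_weight_def to_fract_prod to_fract_power)
  also have "\<dots> = (\<Prod>l = 1..?n - 1. \<Prod>e\<in>{e \<in> E. ?c (Suc (fst e)) (snd e) = l}. 1 - ?t ^ ?c (Suc (fst e)) (snd e))"
    by (rule prod.cong) (simp_all add: d)
  also have "\<dots> = (\<Prod>e\<in>E. 1 - ?t ^ ?c (Suc (fst e)) (snd e))"
  proof (rule prod.group[OF fin])
    show "(\<lambda>e. ?c (Suc (fst e)) (snd e)) ` E \<subseteq> {1..?n - 1}"
    proof clarify
      fix i x assume "(i, x) \<in> E"
      then have "?c (Suc i) x \<ge> 1" "?c (Suc i) x \<le> length (gt_row s (Suc i))"
        by (auto simp only: E_def count_le_length)
      then show "?c (Suc (fst (i, x))) (snd (i, x)) \<in> {1..?n - 1}" by simp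
    qed
  qed simp
  also have "E = Sigma {..<?n - 1} (\<lambda>i. {x \<in> set (gt_row s (Suc i)). ?c (Suc i) x = Suc (?c i x)})"
    by (auto simp: E_def)
  also have "(\<Prod>e\<in>\<dots>. 1 - ?t ^ ?c (Suc (fst e)) (snd e)) =
      (\<Prod>i<?n - 1. \<Prod>x\<in>{x \<in> set (gt_row s (Suc i)). ?c (Suc i) x = Suc (?c i x)}. 1 - ?t ^ ?c (Suc i) x)"
    by (subst prod.Sigma) (auto simp: case_prod_unfold)
  also have "\<dots> = (\<Prod>i<?n - 1. row_weight ?t (gt_row s i) (gt_row s (Suc i)))"
    unfolding row_weight_def step_factor_def
    by (rule prod.cong[OF refl], rule prod.inter_filter) simp
  finally show ?thesis .
qed

section \<open>Weights depend only on the tight inequalities\<close>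

lemma count_list_map_inj_on:
  assumes "inj_on h (insert x (set r))"
  shows "count_list (map h r) (h x) = count_list r x"
  using assms by (induction r) (auto simp: inj_on_def)

text \<open>The weight sees only which entries coincide, so it survives an injective relabelling of
  the values.\<close>

lemma row_weight_map:
  assumes "inj_on h (set r \<union> set r')"
  shows "row_weight t (map h r) (map h r') = row_weight t r r'"
proof -
  have "row_weight t (map h r) (map h r') =
      (\<Prod>x\<in>set r'. step_factor t (count_list (map h r) (h x)) (count_list (map h r') (h x)))"
    unfolding row_weight_def set_map
    by (subst prod.reindex) (use assms in \<open>auto intro: inj_on_subset\<close>)
  also have "\<dots> = row_weight t r r'"
    unfolding row_weight_def
  proof (rule prod.cong[OF refl])
    fix x assume "x \<in> set r'"
    then have "inj_on h (insert x (set r))" "inj_on h (insert x (set r'))"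
      by (intro inj_on_subset[OF assms]; force)+
    then show "step_factor t (count_list (map h r) (h x)) (count_list (map h r') (h x)) =
        step_factor t (count_list r x) (count_list r' x)"
      by (simp add: count_list_map_inj_on)
  qed
  finally show ?thesis .
qed

text \<open>In a decreasing sequence two terms agree exactly if all consecutive terms between them
  do, so the consecutive ties determine all ties.\<close>

lemma decreasing_same_ties:
  fixes f f' :: "nat \<Rightarrow> real"
  assumes "\<And>k. k < N \<Longrightarrow> f (Suc k) \<le> f k" "\<And>k. k < N \<Longrightarrow> f' (Suc k) \<le> f' k"
    and "\<And>k. k < N \<Longrightarrow> f (Suc k) = f k \<longleftrightarrow> f' (Suc k) = f' k"
    and "a \<le> N" "b \<le> N"
  shows "f a = f b \<longleftrightarrow> f' a = f' b"
proof -
  have *: "f b \<le> f a \<and> f' b \<le> f' a \<and> (f a = f b \<longleftrightarrow> f' a = f' b)" if "a \<le> b" "b \<le> N" for a b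
    using that
  proof (induction b rule: dec_induct)
    case (step b)
    then show ?case
      using assms(1)[of b] assms(2)[of b] assms(3)[of b] by auto
  qed simp
  show ?thesis
    using * assms(4,5) by (metis nat_le_linear)
qed

text \<open>Two consecutive rows interleave to a single decreasing sequence, whose ties are the tight
  inequalities between the two rows.\<close>

lemma row_weight_tight_cong:
  fixes s s' :: "real ^ ('n::finite) gt_index"
  assumes s: "interlacing s" "interlacing s'"
    and tight: "tight_left s = tight_left s'" "tight_right s = tight_right s'"
    and i: "Suc i < CARD('n)"
  shows "row_weight t (gt_row s i) (gt_row s (Suc i)) = row_weight t (gt_row s' i) (gt_row s' (Suc i))"
proof -
  \<comment> \<open>Row \<open>i\<close> takes the even positions from 0 to \<open>N\<close>, row
    \<open>Suc i\<close> the odd positions between them.\<close>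
  define N where "N = 2 * (CARD('n) - Suc i)"
  define z where "z s k = (if even k then entry s i (Suc (k div 2)) else entry s (Suc i) (Suc (k div 2)))"
    for s :: "real ^ 'n gt_index" and k
  have z_even: "z s (2 * j) = entry s i (Suc j)" and z_odd: "z s (Suc (2 * j)) = entry s (Suc i) (Suc j)"
    for s j by (simp_all add: z_def)
  have step: "z s (Suc k) \<le> z s k" if "interlacing s" "k < N" for s k
  proof (cases "even k")
    case True
    then obtain j where "k = 2 * j" by (elim evenE)
    then show ?thesis
      using interlacing_cell(1)[OF that(1), of "Suc j" i] that(2) by (simp add: z_def N_def)
  next
    case False
    then obtain j where "k = 2 * j + 1" by (elim oddE)
    then show ?thesis
      using interlacing_cell(2)[OF that(1), of "Suc j" i] that(2) by (simp add: z_def N_def)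
  qed
  have tie: "z s (Suc k) = z s k \<longleftrightarrow> z s' (Suc k) = z s' k" if "k < N" for k
  proof (cases "even k")
    case True
    then obtain j where j: "k = 2 * j" by (elim evenE)
    have c: "(i, Suc j) \<in> cells CARD('n)" using j that by (auto simp: cells_def N_def)
    have "(i, Suc j) \<in> tight_left s \<longleftrightarrow> (i, Suc j) \<in> tight_left s'" by (simp add: tight)
    then show ?thesis using j c by (simp add: tight_left_def z_def)
  next
    case False
    then obtain j where j: "k = 2 * j + 1" by (elim oddE)
    have c: "(i, Suc j) \<in> cells CARD('n)" using j that by (auto simp: cells_def N_def)
    have "(i, Suc j) \<in> tight_right s \<longleftrightarrow> (i, Suc j) \<in> tight_right s'" by (simp add: tight)
    then show ?thesis using j c by (auto simp: tight_right_def z_def)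
  qed
  have ties: "z s a = z s b \<longleftrightarrow> z s' a = z s' b" if "a \<le> N" "b \<le> N" for a b
    by (rule decreasing_same_ties[of N]) (use step s tie that in auto)
  \<comment> \<open>\<open>h\<close> sends a value of \<open>s\<close> to the value of
    \<open>s'\<close> at the same position; by \<open>ties\<close> the choice among positions is
    immaterial.\<close>
  define h where "h x = z s' (SOME k. k \<le> N \<and> z s k = x)" for x
  have h: "h (z s k) = z s' k" if "k \<le> N" for k
  proof -
    have "(SOME l. l \<le> N \<and> z s l = z s k) \<le> N \<and> z s (SOME l. l \<le> N \<and> z s l = z s k) = z s k"
      by (rule someI[of "\<lambda>l. l \<le> N \<and> z s l = z s k" k]) (use that in simp)
    then show ?thesis using ties that by (auto simp: h_def)
  qed
  have inj: "inj_on h (z s ` {..N})"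
    by (rule inj_onI) (auto simp: h ties)
  have upper: "entry s i (Suc j) \<in> z s ` {..N}" "h (entry s i (Suc j)) = entry s' i (Suc j)"
    if "j < CARD('n) - i" for j
  proof -
    have "2 * j \<le> N" using that by (simp add: N_def)
    then show "entry s i (Suc j) \<in> z s ` {..N}" "h (entry s i (Suc j)) = entry s' i (Suc j)"
      using h[of "2 * j"] z_even[of s j] z_even[of s' j] by (auto intro!: image_eqI[of _ _ "2 * j"])
  qed
  have lower: "entry s (Suc i) (Suc j) \<in> z s ` {..N}"
      "h (entry s (Suc i) (Suc j)) = entry s' (Suc i) (Suc j)"
    if "j < CARD('n) - Suc i" for j
  proof -
    have "Suc (2 * j) \<le> N" using that by (simp add: N_def)
    then show "entry s (Suc i) (Suc j) \<in> z s ` {..N}"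
      "h (entry s (Suc i) (Suc j)) = entry s' (Suc i) (Suc j)"
      using h[of "Suc (2 * j)"] z_odd[of s j] z_odd[of s' j]
      by (auto intro!: image_eqI[of _ _ "Suc (2 * j)"])
  qed
  have "gt_row s' i = map h (gt_row s i)" "gt_row s' (Suc i) = map h (gt_row s (Suc i))"
    using upper(2) lower(2) by (auto intro!: nth_equalityI)
  moreover have "set (gt_row s i) \<union> set (gt_row s (Suc i)) \<subseteq> z s ` {..N}"
    using upper(1) lower(1) by (auto simp: in_set_conv_nth)
  ultimately show ?thesis
    using row_weight_map[OF inj_on_subset[OF inj]] by metis
qed

lemma array_weight_tight_cong:
  fixes s s' :: "real ^ ('n::finite) gt_index"
  assumes "interlacing s" "interlacing s'"
    and "tight_left s = tight_left s'" "tight_right s = tight_right s'"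
  shows "array_weight s = array_weight s'"
proof -
  have "to_fract (array_weight s) = to_fract (array_weight s')"
    unfolding to_fract_array_weight
    by (rule prod.cong[OF refl], rule row_weight_tight_cong) (use assms in auto)
  then show ?thesis by simp
qed

text \<open>The point selected in \<open>face_weight\<close> lies in the same relative interior as
  \<open>s\<close>. Hence it spans the same face and has the same tight inequalities.\<close>

lemma face_weight_face_at:
  assumes "s \<in> gt_set g"
  shows "face_weight (face_at g s) = array_weight s"
proof -
  define s' where "s' = (SOME p. p \<in> rel_interior (face_at g s))"
  have s': "s' \<in> rel_interior (face_at g s)"
    unfolding s'_def by (rule someI, rule mem_rel_interior_face_at[OF assms])
  then have P: "s' \<in> gt_set g"
    using rel_interior_subset by (fastforce simp: face_at_def)
  then have eq: "face_at g s' = face_at g s"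
    using face_of_eq[OF face_at_face_of face_at_face_of] mem_rel_interior_face_at s' by blast
  have "array_weight s' = array_weight s"
    using P assms face_at_eq_tight[OF P assms eq] by (intro array_weight_tight_cong) (auto simp: gt_set_def)
  then show ?thesis by (simp add: face_weight_def s'_def)
qed

lemma card_free_cells:
  fixes s :: "real ^ ('n::finite) gt_index"
  shows "card (free_cells s) = (\<Sum>i<CARD('n) - 1. free_entries (gt_row s i) (gt_row s (Suc i)))"
proof -
  let ?J = "\<lambda>i. {j. j < CARD('n) - Suc i \<and> entry s (Suc i) (Suc j) \<noteq> entry s i (Suc j) \<and>
      entry s (Suc i) (Suc j) \<noteq> entry s i (Suc (Suc j))}"
  have "free_cells s = (\<lambda>(i, j). (i, Suc j)) ` Sigma {..<CARD('n) - 1} ?J"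
  proof (intro subset_antisym subsetI)
    fix c assume c: "c \<in> free_cells s"
    then obtain i j where "c = (i, Suc j)"
      by (cases c; cases "snd c") (auto simp: free_cells_def cells_def)
    moreover from this have "(i, j) \<in> Sigma {..<CARD('n) - 1} ?J"
      using c by (auto simp: free_cells_def cells_def tight_left_def tight_right_def)
    ultimately show "c \<in> (\<lambda>(i, j). (i, Suc j)) ` Sigma {..<CARD('n) - 1} ?J" by force
  qed (auto simp: free_cells_def cells_def tight_left_def tight_right_def)
  moreover have "inj_on (\<lambda>(i, j). (i, Suc j)) A" for A :: "(nat \<times> nat) set"
    by (auto simp: inj_on_def)
  ultimately have "card (free_cells s) = card (Sigma {..<CARD('n) - 1} ?J)"
    by (simp add: card_image)
  also have "\<dots> = (\<Sum>i<CARD('n) - 1. card (?J i))"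
    by (rule card_SigmaI) auto
  also have "\<dots> = (\<Sum>i<CARD('n) - 1. free_entries (gt_row s i) (gt_row s (Suc i)))"
  proof (rule sum.cong[OF refl])
    fix i assume "i \<in> {..<CARD('n) - 1}"
    then have len: "length (gt_row s i) = Suc (length (gt_row s (Suc i)))" by auto
    show "card (?J i) = free_entries (gt_row s i) (gt_row s (Suc i))"
      unfolding free_entries_eq_card[OF len]
      by (rule arg_cong[where f = card]) auto
  qed
  finally show ?thesis .
qed

section \<open>Midpoint arrays correspond to chains of rows\<close>

lemma array_eqI_rows:
  fixes s s' :: "real ^ ('n::finite) gt_index"
  assumes "\<And>i. i < CARD('n) \<Longrightarrow> gt_row s i = gt_row s' i"
  shows "s = s'"
proof (rule array_eqI)
  fix i j assume ij: "1 \<le> j" "i + j \<le> CARD('n)"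
  then have "gt_row s i ! (j - 1) = gt_row s' i ! (j - 1)" using assms[of i] by simp
  then show "entry s i j = entry s' i j" using ij by simp
qed

text \<open>\<open>next_rows\<close> imposes no order, so interlacing has to be recovered: a
  decreasing top row makes all rows below it decreasing, and then each of the three choices lies
  between its upper neighbours.\<close>

lemma bij_betw_row_chains:
  fixes g :: "nat \<Rightarrow> real"
  assumes g: "\<And>j. 1 \<le> j \<Longrightarrow> Suc j \<le> CARD('n::finite) \<Longrightarrow> g (Suc j) \<le> g j"
  shows "bij_betw (\<lambda>s. map (gt_row s) [0..<CARD('n)])
    (midpoint_arrays g :: (real ^ 'n gt_index) set)
    (row_chains (CARD('n) - 1) (map g [1..<Suc CARD('n)]))"
proof (rule bij_betwI')
  let ?n = "CARD('n)"
  fix s s' :: "real ^ 'n gt_index"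
  show "map (gt_row s) [0..<?n] = map (gt_row s') [0..<?n] \<longleftrightarrow> s = s'"
    by (auto intro: array_eqI_rows)
next
  let ?n = "CARD('n)" and ?r = "map g [1..<Suc CARD('n)]"
  note upt_Suc [simp del]
  fix s :: "real ^ 'n gt_index" assume s: "s \<in> midpoint_arrays g"
  have "gt_row s 0 = ?r"
    using s by (auto simp: gt_row_def midpoint_arrays_def gt_set_def)
  moreover have "gt_row s (Suc i) \<in> next_rows (gt_row s i)" if "i < ?n - 1" for i
  proof -
    have "gt_row s i \<noteq> []" using that by (simp flip: length_greater_0_conv)
    moreover have "entry s (Suc i) (Suc j) \<in> {entry s i (Suc j), entry s i (Suc (Suc j)),
        (entry s i (Suc j) + entry s i (Suc (Suc j))) / 2}" if "j < ?n - Suc i" for j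
    proof -
      have "(i, Suc j) \<in> cells ?n" using that by (auto simp: cells_def)
      then show ?thesis using s by (auto simp: midpoint_arrays_def)
    qed
    ultimately show ?thesis
      using that by (subst mem_next_rows_iff) auto
  qed
  ultimately show "map (gt_row s) [0..<?n] \<in> row_chains (?n - 1) ?r"
    by (simp add: mem_row_chains_iff)
next
  let ?n = "CARD('n)" and ?r = "map g [1..<Suc CARD('n)]"
  note upt_Suc [simp del]
  fix c assume "c \<in> row_chains (?n - 1) ?r"
  then have len: "length c = ?n" and c0: "c ! 0 = ?r"
    and next_row: "\<And>i. i < ?n - 1 \<Longrightarrow> c ! Suc i \<in> next_rows (c ! i)"
    by (auto simp: mem_row_chains_iff)
  have len_c: "length (c ! i) = ?n - i" if "i < ?n" for i
    using that
  proof (induction i)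
    case (Suc i)
    then have "length (c ! i) = ?n - i" "c ! Suc i \<in> next_rows (c ! i)"
      using next_row by auto
    moreover from this(1) have "c ! i \<noteq> []" using Suc.prems by auto
    ultimately show ?case by (auto simp: mem_next_rows_iff)
  qed (simp add: c0)
  \<comment> \<open>Columns are counted from 1, list positions from 0.\<close>
  define s :: "real ^ 'n gt_index" where "s = array_of (\<lambda>i j. c ! i ! (j - 1))"
  have s: "entry s i j = c ! i ! (j - 1)" if "1 \<le> j" "i + j \<le> ?n" for i j
    using that by (simp add: s_def entry_array_of)
  have row: "gt_row s i = c ! i" if "i < ?n" for i
    using that by (intro nth_equalityI) (auto simp: len_c s)
  have mid: "entry s (Suc i) j \<in> {entry s i j, entry s i (Suc j), (entry s i j + entry s i (Suc j)) / 2}"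
    if "(i, j) \<in> cells ?n" for i j
  proof -
    have ij: "1 \<le> j" "i + j < ?n" using that by (auto simp: cells_def)
    have "gt_row s (Suc i) \<in> next_rows (gt_row s i)"
      using next_row[of i] ij by (simp add: row)
    moreover have ne: "gt_row s i \<noteq> []" using ij by (simp flip: length_greater_0_conv)
    moreover have "j - 1 < length (gt_row s (Suc i))" using ij by simp
    ultimately have "gt_row s (Suc i) ! (j - 1) \<in> {gt_row s i ! (j - 1), gt_row s i ! Suc (j - 1),
        (gt_row s i ! (j - 1) + gt_row s i ! Suc (j - 1)) / 2}"
      unfolding mem_next_rows_iff[OF ne] by blast
    then show ?thesis using ij by simp
  qed
  have dec: "entry s i (Suc j) \<le> entry s i j" if "1 \<le> j" "i + Suc j \<le> ?n" for i j
    using that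
  proof (induction i arbitrary: j)
    case 0
    then show ?case using g[of j] by (simp add: s c0)
  next
    case (Suc i)
    have "entry s i (Suc j) \<le> entry s i j" "entry s i (Suc (Suc j)) \<le> entry s i (Suc j)"
      using Suc by auto
    then show ?case
      using mid[of i j] mid[of i "Suc j"] Suc.prems by (auto simp: cells_def)
  qed
  have "interlacing s"
    unfolding interlacing_def
  proof (intro allI impI)
    fix i j assume c: "(i, j) \<in> cells ?n"
    then have "entry s i (Suc j) \<le> entry s i j" using dec by (auto simp: cells_def)
    then show "entry s (Suc i) j \<le> entry s i j \<and> entry s i (Suc j) \<le> entry s (Suc i) j"
      using mid[OF c] by auto
  qed
  moreover have "entry s 0 j = g j" if "j \<in> {1..?n}" for j
    using that by (auto simp: s c0)
  ultimately have "s \<in> midpoint_arrays g"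
    using mid by (auto simp: midpoint_arrays_def gt_set_def)
  moreover have "c = map (gt_row s) [0..<?n]"
    using len row by (auto intro!: nth_equalityI)
  ultimately show "\<exists>s \<in> midpoint_arrays g :: (real ^ 'n gt_index) set. c = map (gt_row s) [0..<?n]" by blast
qed

section \<open>Evaluation in the fraction field\<close>

lemma to_fract_t_fact: "to_fract (t_fact l) = q_fact (to_fract t_var) l"
  by (simp add: t_fact_def q_fact_def q_num_def to_fract_prod to_fract_power)

text \<open>At \<open>t = 1\<close> the polynomial takes the value \<open>Suc l\<close>, so the
  q-factorials may be used as denominators.\<close>

lemma q_num_t_var_nonzero: "q_num (to_fract t_var) (Suc l) \<noteq> 0"
proof
  assume "q_num (to_fract t_var) (Suc l) = 0"
  then have "to_fract (\<Sum>k<Suc l. t_var ^ k) = 0"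
    by (simp only: q_num_def to_fract_sum to_fract_power)
  then have "(\<Sum>k<Suc l. t_var ^ k) = 0"
    by (simp only: to_fract_eq_0_iff)
  then have "poly (\<Sum>k<Suc l. t_var ^ k) 1 = 0" by (simp only: poly_0)
  then have "(\<Sum>k<Suc l. 1 :: int) = 0" by (simp add: poly_sum poly_power del: sum.lessThan_Suc)
  then show False by simp
qed

text \<open>The order of the distinct parts is immaterial in the product, and the embedding of
  \<open>nat\<close> into \<open>real\<close> preserves multiplicities.\<close>

lemma partition_type_prod:
  "(\<Prod>l\<leftarrow>partition_type xs. to_fract (t_fact l)) = count_fact (to_fract t_var) (map real xs)"
proof -
  have "(\<Prod>l\<leftarrow>partition_type xs. to_fract (t_fact l)) =
      (\<Prod>x\<leftarrow>rev (sorted_list_of_set (set xs)). q_fact (to_fract t_var) (count_list xs x))"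
    by (simp add: partition_type_def to_fract_t_fact o_def)
  also have "\<dots> = (\<Prod>x\<in>set xs. q_fact (to_fract t_var) (count_list xs x))"
    by (subst prod.distinct_set_conv_list[symmetric]) auto
  also have "\<dots> = (\<Prod>x\<in>set xs. q_fact (to_fract t_var) (count_list (map real xs) (real x)))"
    by (simp add: count_list_map_inj_on inj_on_def)
  also have "\<dots> = count_fact (to_fract t_var) (map real xs)"
    unfolding count_fact_def set_map by (subst prod.reindex) (auto simp: inj_on_def)
  finally show ?thesis .
qed

text \<open>Faces are replaced by midpoint arrays and these by chains. Sign and weight are both
  products over consecutive rows, so the sums agree term by term.\<close>

lemma sum_faces_gt_set:
  fixes g :: "nat \<Rightarrow> real"
  assumes g: "\<And>j. 1 \<le> j \<Longrightarrow> Suc j \<le> CARD('n::finite) \<Longrightarrow> g (Suc j) \<le> g j"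
  shows "to_fract (\<Sum>f | f face_of (gt_set g :: (real ^ 'n gt_index) set) \<and> f \<noteq> {}.
      (-1) ^ nat (aff_dim f) * face_weight f) =
    (\<Sum>c\<in>row_chains (CARD('n) - 1) (map g [1..<Suc CARD('n)]). chain_weight (to_fract t_var) c)"
proof -
  let ?M = "midpoint_arrays g :: (real ^ 'n gt_index) set"
  have "(\<Sum>f | f face_of (gt_set g :: (real ^ 'n gt_index) set) \<and> f \<noteq> {}.
      (-1) ^ nat (aff_dim f) * face_weight f) =
    (\<Sum>s\<in>?M. (-1) ^ nat (aff_dim (face_at g s)) * face_weight (face_at g s))"
    unfolding faces_gt_set face_at_image by (simp add: sum.reindex[OF inj_on_face_at])
  also have "\<dots> = (\<Sum>s\<in>?M. (-1) ^ card (free_cells s) * array_weight s)"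
  proof (rule sum.cong[OF refl])
    fix s assume "s \<in> ?M"
    then have "s \<in> gt_set g" "interlacing s" by (simp_all add: midpoint_arrays_def gt_set_def)
    then show "(-1) ^ nat (aff_dim (face_at g s)) * face_weight (face_at g s) =
        (-1) ^ card (free_cells s) * array_weight s"
      by (simp add: aff_dim_face_at face_weight_face_at dim_directions)
  qed
  also have "to_fract \<dots> = (\<Sum>s\<in>?M. chain_weight (to_fract t_var) (map (gt_row s) [0..<CARD('n)]))"
    unfolding to_fract_sum
  proof (rule sum.cong[OF refl])
    fix s :: "real ^ 'n gt_index"
    have "chain_weight (to_fract t_var) (map (gt_row s) [0..<CARD('n)]) =
        (\<Prod>i<CARD('n) - 1. (-1) ^ free_entries (gt_row s i) (gt_row s (Suc i)) *
          row_weight (to_fract t_var) (gt_row s i) (gt_row s (Suc i)))"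
      unfolding chain_weight_eq_prod by (rule prod.cong) auto
    also have "\<dots> = (-1) ^ card (free_cells s) * to_fract (array_weight s)"
      by (simp add: prod.distrib card_free_cells to_fract_array_weight power_sum)
    finally show "to_fract ((-1) ^ card (free_cells s) * array_weight s) =
        chain_weight (to_fract t_var) (map (gt_row s) [0..<CARD('n)])"
      by (simp add: to_fract_power)
  qed
  also have "\<dots> = (\<Sum>c\<in>row_chains (CARD('n) - 1) (map g [1..<Suc CARD('n)]). chain_weight (to_fract t_var) c)"
    by (rule sum.reindex_bij_betw[OF bij_betw_row_chains]) (rule g)
  finally show ?thesis .
qed

lemma weight_coord_antimono: "weight_coord n a (Suc j) \<le> weight_coord n a j"
  unfolding weight_coord_def by (rule sum_mono2) auto

theorem theorem9:
  fixes a :: "nat \<Rightarrow> nat"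
  assumes "CARD('n::finite) \<ge> 2"
    and "\<exists>k \<in> {1..CARD('n) - 1}. a k \<noteq> 0"
  shows "to_fract
      (\<Sum>f | f face_of (GT_polytope a :: (real ^ 'n gt_index) set) \<and> f \<noteq> {}.
         (-1) ^ nat (aff_dim f) * face_weight f)
    = t_multinomial CARD('n)
        (partition_type (map (weight_coord CARD('n) a) [1..<CARD('n)] @ [0]))"
proof -
  let ?n = "CARD('n)" and ?t = "to_fract t_var"
  let ?xs = "map (weight_coord CARD('n) a) [1..<CARD('n)] @ [0]"
  define g where "g j = real (weight_coord ?n a j)" for j
  \<comment> \<open>At \<open>?n\<close> the sum defining \<open>g\<close> is empty, which accounts
    for the appended part 0.\<close>
  have xs: "map g [1..<Suc ?n] = map real ?xs"
    using assms(1) by (simp add: g_def weight_coord_def)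
  have "sorted_wrt (\<ge>) (map g [1..<Suc ?n])"
  proof -
    have "antimono g"
      by (simp add: antimono_iff_le_Suc g_def weight_coord_antimono)
    then have "sorted_wrt (\<lambda>i j. g i \<ge> g j) [1..<Suc ?n]"
      by (intro sorted_wrt_mono_rel[OF _ sorted_wrt_upt]) (auto simp: antimono_def)
    then show ?thesis by (simp add: sorted_wrt_map del: upt_Suc)
  qed
  then have "(\<Sum>c\<in>row_chains (?n - 1) (map g [1..<Suc ?n]). chain_weight ?t c) *
      count_fact ?t (map g [1..<Suc ?n]) = q_fact ?t (Suc (?n - 1))"
    by (rule sum_chain_weight[OF q_num_t_var_nonzero]) (use assms(1) in simp)
  moreover have "count_fact ?t (map g [1..<Suc ?n]) \<noteq> 0"
    using q_fact_nonzero[OF q_num_t_var_nonzero] by (simp add: count_fact_def)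
  ultimately have "(\<Sum>c\<in>row_chains (?n - 1) (map g [1..<Suc ?n]). chain_weight ?t c) =
      q_fact ?t ?n / count_fact ?t (map g [1..<Suc ?n])"
    using assms(1) by (simp add: eq_divide_eq)
  also have "\<dots> = t_multinomial ?n (partition_type ?xs)"
    unfolding t_multinomial_def partition_type_prod xs by (simp only: to_fract_t_fact)
  finally show ?thesis
    unfolding GT_polytope_eq_gt_set g_def[symmetric]
    by (subst sum_faces_gt_set) (simp_all add: g_def weight_coord_antimono del: upt_Suc)
qed

end
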